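(* Let $\mu\in\mathbb{R}$ and consider, for a real-valued function $w$ on $\mathbb{R}$, the equation $$\mathcal{H}w'=\mu\bigl(w+w\,\mathcal{H}w'+\mathcal{H}(ww')\bigr)\quad\text{on }\mathbb{R}. \qquad ( * )$$ (i) In the case $\mu>0$: if $w\in H^1(\mathbb{R})\cap C^{1+\alpha}_{1+\epsilon}(\mathbb{R})$ satisfies $( * )$ for some $\alpha\in(0,1)$ and some $\epsilon\in(0,1)$, then $w\equiv 0$. (ii) In the case $\mu\leq 0$: if $w\in H^1(\mathbb{R})\cap C^{1+\alpha}(\mathbb{R})$ satisfies $( * )$ for some $\alpha\in(0,1)$ and if in addition $\inf_{x\in\mathbb{R}}(1+\mathcal{H}w'(x))>0$, then $w\equiv 0$.
   Context: Throughout $'=d/dx$. $\mathcal{H}$ is the Hilbert transform on $\mathbb{R}$, $\mathcal{H}v(x)=\frac1\pi\,PV\int_{-\infty}^{\infty}\frac{v(t)}{x-t}\,dt$, where $PV$ is the Cauchy principal value; equivalently $\widehat{\mathcal{H}v}(\xi)=-i\,\mathrm{sgn}(\xi)\hat v(\xi)$. $H^1(\mathbb{R})$ is the $L^2$-based Sobolev space of order 1. For an integer $k\geq 0$, $\alpha\in(0,1)$ and $\rho\in\mathbb{R}$, the weighted H\"older space $C^{k+\alpha}_\rho(\mathbb{R})$ is defined by finiteness of the norm $$\|v\|_{C^{k+\alpha}_\rho(\mathbb{R})}=\sum_{j=0}^k\sup_{x\in\mathbb{R}}\langle x\rangle^{\rho}|v^{(j)}(x)|+\sup_{x\in\mathbb{R}}\sup_{|x-t|\leq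 1}\langle x\rangle^{\rho}\frac{|v^{(k)}(x)-v^{(k)}(t)|}{|x-t|^\alpha},\qquad \langle x\rangle=(1+x^2)^{1/2}.$$ $C^{1+\alpha}(\mathbb{R})$ is the usual (unweighted, $\rho=0$) H\"older space. *)

theory Defs
  imports "HOL-Analysis.Analysis"
begin

text \<open>
  The integral is truncated only at the singularity: for square integrable \<open>v\<close> the
  truncated integrand is absolutely integrable at infinity, so no truncation is needed there.
\<close>

definition hilbert_transform :: "(real \<Rightarrow> real) \<Rightarrow> real \<Rightarrow> real" where
  "hilbert_transform v x =
     (1 / pi) * Lim (at_right 0) (\<lambda>\<delta>. LINT t : {t. \<bar>x - t\<bar> > \<delta>} | lborel. v t / (x - t))"

definition square_integrable :: "(real \<Rightarrow> real) set" where
  "square_integrable = {v. v \<in> borel_measurable lborel \<and> integrable lborel (\<lambda>x. (v x)\<^sup>2)}"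

definition test_functions :: "(real \<Rightarrow> real) set" where
  "test_functions =
     {\<phi>. (\<forall>j x. (deriv ^^ j) \<phi> differentiable (at x)) \<and> compact (closure {x. \<phi> x \<noteq> 0})}"

definition sobolev_H1 :: "(real \<Rightarrow> real) set" where
  "sobolev_H1 =
     {w \<in> square_integrable. \<exists>g \<in> square_integrable. \<forall>\<phi> \<in> test_functions.
        (LINT x | lborel. w x * deriv \<phi> x) = - (LINT x | lborel. g x * \<phi> x)}"

definition japanese_bracket :: "real \<Rightarrow> real" where
  "japanese_bracket x = (1 + x\<^sup>2) powr (1 / 2)"

text \<open>
  The norm takes values in the extended nonnegative reals, so that its finiteness is meaningful.
  The pairs with \<open>t = x\<close> contribute the value \<open>0\<close> to the second supremum.
\<close>

definition weighted_holder_norm :: "nat \<Rightarrow> real \<Rightarrow> real \<Rightarrow> (real \<Rightarrow> real) \<Rightarrow> ennreal" where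
  "weighted_holder_norm k \<alpha> \<rho> v =
     (\<Sum>j\<le>k. SUP x. ennreal (japanese_bracket x powr \<rho> * \<bar>(deriv ^^ j) v x\<bar>))
     + (SUP x. SUP t \<in> {t. \<bar>x - t\<bar> \<le> 1}.
          ennreal (japanese_bracket x powr \<rho>
            * (\<bar>(deriv ^^ k) v x - (deriv ^^ k) v t\<bar> / \<bar>x - t\<bar> powr \<alpha>)))"

definition weighted_holder_space :: "nat \<Rightarrow> real \<Rightarrow> real \<Rightarrow> (real \<Rightarrow> real) set" where
  "weighted_holder_space k \<alpha> \<rho> =
     {v. (\<forall>j<k. \<forall>x. (deriv ^^ j) v differentiable (at x)) \<and> weighted_holder_norm k \<alpha> \<rho> v < \<infinity>}"

end

theory Submission
  imports Defs
begin

text \<open>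
  Write \<open>H\<close> for the Hilbert transform, \<open>D = H w'\<close> and \<open>E = H (w w')\<close>, so that the equation reads
  \<open>D = \<mu> (w + w D + E)\<close>.

  For \<open>\<mu> > 0\<close> the equation is multiplied by \<open>x w'\<close> and integrated. The Hilbert transform is
  antisymmetric, and \<open>x H v - H (x v)\<close> is the constant \<open>(1/\<pi>) \<integral> v\<close>; together this gives
  \<open>\<integral> x (f H g + g H f) = (1/\<pi>) \<integral> f \<integral> g\<close> (lemma \<open>hilbert_weighted_identity\<close>). Since \<open>\<integral> w' = 0\<close>, the
  choice \<open>f = g = w'\<close> removes the left-hand side of the equation, and \<open>f = w'\<close>, \<open>g = w w'\<close> removes
  the two nonlocal terms on the right. What remains is \<open>0 = \<mu> \<integral> x w w' = - (\<mu>/2) \<integral> w\<^sup>2\<close>. In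
  variational terms this is the Pohozaev identity for dilations: \<open>\<integral> w H w'\<close> and \<open>\<integral> w\<^sup>2 H w'\<close> are
  invariant under \<open>w \<mapsto> w (\<lambda> \<cdot>)\<close>, and \<open>\<integral> w\<^sup>2\<close> is not.

  For \<open>\<mu> \<le> 0\<close> the proof is a maximum principle. The operator \<open>u \<mapsto> H u'\<close> is the square root of minus
  the second derivative; like minus the second derivative, it is nonnegative at a maximum of \<open>u\<close>
  (lemma \<open>hilbert_transform_at_max\<close>). Applied to \<open>w\<close>, to \<open>- w\<close> and to \<open>w\<^sup>2/2\<close> this gives the signs of \<open>D\<close>
  and \<open>E\<close> at extremal points. Applied at \<open>t = x\<close> to \<open>t \<mapsto> - (w x - w t)\<^sup>2/2\<close>, whose derivative is
  \<open>w x w' t - w t w' t\<close>, it gives \<open>E \<le> w D\<close> everywhere, hence \<open>(1 - 2 \<mu> w) D \<ge> \<mu> w\<close>. Where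
  \<open>2 \<mu> w = 1\<close> this would say \<open>0 \<ge> 1/2\<close>; as \<open>w\<close> is continuous and vanishes at infinity,
  \<open>1 - 2 \<mu> w\<close> is positive everywhere. At a negative minimum \<open>D < 0\<close> and \<open>\<mu> w \<ge> 0\<close>, a contradiction.
  So \<open>w \<ge> 0\<close>, and at a positive maximum \<open>D > 0\<close> and \<open>E \<ge> 0\<close>, against \<open>\<mu> (w + w D + E) \<le> 0\<close>.

  Both parts use that for a Hoelder continuous, square integrable \<open>f\<close> the principal value is the
  absolutely convergent integral of \<open>(f (x - s) - f (x + s)) / s\<close> over \<open>s > 0\<close> (lemma
  \<open>hilbert_transform_eq_pv\<close>). For \<open>\<mu> \<le> 0\<close> the derivative is square integrable because \<open>w\<close> has a
  weak derivative in \<open>L\<^sup>2\<close>, which the classical derivative equals almost everywhere (lemma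
  \<open>sobolev_H1_square_integrable_deriv\<close>).
\<close>

section \<open>A weak derivative that exists classically is square integrable\<close>

text \<open>
  With \<open>q = (x - a) (b - x)\<close> this is \<open>p q\<^sup>-\<^sup>k exp (- c / q)\<close> on \<open>(a, b)\<close>. The polynomial factor and the
  negative powers of \<open>q\<close> make the family closed under differentiation, so that one derivative
  computation yields smoothness.
\<close>
definition bump :: "real \<Rightarrow> real \<Rightarrow> real \<Rightarrow> real poly \<Rightarrow> nat \<Rightarrow> real \<Rightarrow> real" where
  "bump a b c p k x =
     (if a < x \<and> x < b
      then poly p x * inverse ((x - a) * (b - x)) ^ k * exp (- c * inverse ((x - a) * (b - x)))
      else 0)"

text \<open>
  The exponential beats the pole: \<open>t ^ k exp (- c t)\<close> is bounded for \<open>t \<ge> 0\<close>.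
\<close>
lemma bump_bounded:
  assumes "c > 0"
  obtains K where "\<And>x. \<bar>bump a b c p k x\<bar> \<le> K"
proof -
  have "bounded (poly p ` {a..b})"
    by (intro compact_imp_bounded compact_continuous_image continuous_intros) auto
  then obtain P where "P > 0" "\<forall>y \<in> poly p ` {a..b}. norm y \<le> P"
    using bounded_pos by blast
  then have P: "\<And>x. x \<in> {a..b} \<Longrightarrow> \<bar>poly p x\<bar> \<le> P" by auto
  have exp_bound: "t ^ k * exp (- c * t) \<le> real k ^ k / c ^ k" if "t \<ge> 0" for t
  proof -
    \<comment> \<open>From \<open>c t / k \<le> exp (c t / k)\<close>, raised to the power \<open>k\<close>.\<close>
    have "(c * t) ^ k \<le> real k ^ k * exp (c * t)"
    proof (cases "k = 0")
      case False
      have "c * t / k \<le> exp (c * t / k)"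
        using exp_ge_add_one_self[of "c * t / k"] by linarith
      then have "(c * t / k) ^ k \<le> exp (c * t / k) ^ k"
        using assms that by (intro power_mono) auto
      also have "\<dots> = exp (c * t)" using False by (simp flip: exp_of_nat_mult)
      finally show ?thesis using False by (simp add: field_simps power_divide)
    qed (use assms that in auto)
    then show ?thesis using assms that by (simp add: exp_minus field_simps power_mult_distrib)
  qed
  have "\<bar>bump a b c p k x\<bar> \<le> P * (real k ^ k / c ^ k)" for x
  proof (cases "a < x \<and> x < b")
    case True
    define t where "t = inverse ((x - a) * (b - x))"
    have "t \<ge> 0" using True by (simp add: t_def)
    then have "\<bar>bump a b c p k x\<bar> = \<bar>poly p x\<bar> * (t ^ k * exp (- c * t))"
      using True by (simp add: bump_def t_def abs_mult)
    also have "\<dots> \<le> P * (real k ^ k / c ^ k)"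
      using True P[of x] exp_bound[OF \<open>t \<ge> 0\<close>] \<open>t \<ge> 0\<close> \<open>P > 0\<close> by (intro mult_mono) auto
    finally show ?thesis .
  next
    case False then show ?thesis using \<open>P > 0\<close> assms by (auto simp: bump_def)
  qed
  then show ?thesis using that by blast
qed

text \<open>
  Trading two powers of \<open>1 / q\<close> for a factor \<open>q\<^sup>2\<close> shows that a bump vanishes to second order at the
  endpoints.
\<close>
lemma bump_factor:
  "bump a b c p k x = ((x - a) * (b - x))\<^sup>2 * bump a b c p (k + 2) x"
proof (cases "a < x \<and> x < b")
  case True
  define z where "z = (x - a) * (b - x)"
  have "z > 0" using True by (simp add: z_def)
  then have "inverse z ^ k = z\<^sup>2 * inverse z ^ (k + 2)"
    by (simp add: power_add power2_eq_square field_simps)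
  then show ?thesis using True unfolding bump_def z_def[symmetric] by simp
qed (auto simp: bump_def)

text \<open>
  Inside \<open>(a, b)\<close>, with \<open>s = 1 / q\<close> and \<open>s' = - s\<^sup>2 q'\<close>, every term of the derivative of
  \<open>p s ^ k exp (- c s)\<close> is a polynomial times \<open>s ^ (k + 2) exp (- c s)\<close>, because missing powers of
  \<open>s\<close> can be filled up by \<open>1 = s q\<close>. At the endpoints the derivative is zero by the second order
  vanishing.
\<close>
lemma bump_has_derivative:
  assumes "c > 0" "a < b"
  shows "\<exists>p'. \<forall>x. (bump a b c p k has_real_derivative bump a b c p' (k + 2) x) (at x)"
proof -
  define q where "q = [: - a * b, a + b, - 1 :]"
  have q: "poly q x = (x - a) * (b - x)" for x by (simp add: q_def algebra_simps)
  have q': "poly (pderiv q) x = a + b - 2 * x" for x by (simp add: q_def pderiv_pCons algebra_simps)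
  define p' where "p' = pderiv p * q\<^sup>2 - smult (of_nat k) (p * q * pderiv q) + smult c (p * pderiv q)"
  have "(bump a b c p k has_real_derivative bump a b c p' (k + 2) x) (at x)" for x
  proof -
    consider "a < x \<and> x < b" | "x < a \<or> b < x" | "x = a \<or> x = b" using assms by linarith
    then show ?thesis
    proof cases
      case 1
      define s where "s = (\<lambda>x. inverse (poly q x))"
      have nz: "poly q x > 0" using 1 by (simp add: q)
      have ds: "(s has_real_derivative - (s x ^ 2 * poly (pderiv q) x)) (at x)"
        unfolding s_def using nz by (auto intro!: derivative_eq_intros poly_DERIV simp: power2_eq_square)
      have "((\<lambda>x. poly p x * s x ^ k * exp (- c * s x)) has_real_derivative
               (poly (pderiv p) x * s x ^ k
                 + (of_nat k * (- (s x ^ 2 * poly (pderiv q) x) * s x ^ (k - Suc 0))) * poly p x) * exp (- c * s x)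
               + exp (- c * s x) * (- c * - (s x ^ 2 * poly (pderiv q) x)) * (poly p x * s x ^ k)) (at x)"
        by (intro DERIV_mult DERIV_power poly_DERIV ds DERIV_fun_exp DERIV_cmult)
      also have "(poly (pderiv p) x * s x ^ k
                 + (of_nat k * (- (s x ^ 2 * poly (pderiv q) x) * s x ^ (k - Suc 0))) * poly p x) * exp (- c * s x)
               + exp (- c * s x) * (- c * - (s x ^ 2 * poly (pderiv q) x)) * (poly p x * s x ^ k)
            = bump a b c p' (k + 2) x"
      proof -
        have sq: "s x * poly q x = 1" using nz by (simp add: s_def)
        define t where "t = s x ^ (k + 2)"
        have e1: "of_nat k * (s x ^ 2 * s x ^ (k - Suc 0)) = of_nat k * (t * poly q x)"
        proof (cases k)
          case (Suc m)
          have "t * poly q x = s x ^ (m + 2) * (s x * poly q x)"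
            by (simp add: t_def Suc algebra_simps)
          then show ?thesis using Suc sq by (simp add: power_add algebra_simps power2_eq_square)
        qed simp
        have e2: "s x ^ k = t * poly q x ^ 2"
        proof -
          have "t * poly q x ^ 2 = s x ^ k * (s x * poly q x) ^ 2"
            unfolding t_def power_add power_mult_distrib by (rule mult.assoc)
          then show ?thesis unfolding sq power_one mult_1_right by (rule sym)
        qed
        have e3: "s x ^ 2 * s x ^ k = t" unfolding t_def power_add by (rule mult.commute)
        have b: "bump a b c p' (k + 2) x = poly p' x * t * exp (- c * s x)"
          using 1 by (simp add: bump_def t_def s_def q)
        have "(poly (pderiv p) x * s x ^ k
                 + (of_nat k * (- (s x ^ 2 * poly (pderiv q) x) * s x ^ (k - Suc 0))) * poly p x) * exp (- c * s x)
               + exp (- c * s x) * (- c * - (s x ^ 2 * poly (pderiv q) x)) * (poly p x * s x ^ k)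
            = exp (- c * s x) * (poly (pderiv p) x * s x ^ k
                 - of_nat k * (s x ^ 2 * s x ^ (k - Suc 0)) * poly (pderiv q) x * poly p x
                 + c * (s x ^ 2 * s x ^ k) * poly (pderiv q) x * poly p x)"
          by (simp add: algebra_simps)
        also have "\<dots> = poly p' x * t * exp (- c * s x)"
          unfolding e1 e3 unfolding e2 p'_def by (simp add: algebra_simps power2_eq_square)
        finally show ?thesis using b by simp
      qed
      finally show ?thesis
        by (rule has_field_derivative_transform_within_open[where S = "{a<..<b}"])
           (use 1 in \<open>auto simp: bump_def q s_def\<close>)
    next
      case 2
      have "((\<lambda>_. 0) has_real_derivative 0) (at x)" by simp
      then have "(bump a b c p k has_real_derivative 0) (at x)"
        by (rule has_field_derivative_transform_within_open[where S = "{..<a} \<union> {b<..}"])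
           (use 2 in \<open>auto simp: bump_def\<close>)
      then show ?thesis using 2 by (auto simp: bump_def)
    next
      case 3
      obtain K where K: "\<And>x. \<bar>bump a b c p (k + 2) x\<bar> \<le> K"
        using bump_bounded[OF assms(1)] by blast
      have zero: "bump a b c p k x = 0" "bump a b c p' (k + 2) x = 0" using 3 by (auto simp: bump_def)
      have "((\<lambda>y. (bump a b c p k y - bump a b c p k x) / (y - x)) \<longlongrightarrow> 0) (at x)"
      proof (rule Lim_null_comparison)
        show "\<forall>\<^sub>F y in at x. norm ((bump a b c p k y - bump a b c p k x) / (y - x))
                \<le> \<bar>y - x\<bar> * (y - (a + b - x))\<^sup>2 * K"
        proof (rule always_eventually, rule allI)
          fix y
          have "((y - a) * (b - y))\<^sup>2 = \<bar>y - x\<bar>\<^sup>2 * (y - (a + b - x))\<^sup>2"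
            using 3 by (auto simp: power2_eq_square algebra_simps)
          then have "\<bar>bump a b c p k y / (y - x)\<bar>
              = \<bar>y - x\<bar> * (y - (a + b - x))\<^sup>2 * \<bar>bump a b c p (k + 2) y\<bar>"
            using zero by (subst bump_factor) (auto simp: abs_mult power2_eq_square)
          then show "norm ((bump a b c p k y - bump a b c p k x) / (y - x))
                \<le> \<bar>y - x\<bar> * (y - (a + b - x))\<^sup>2 * K"
            using K[of y] by (simp add: zero mult_left_mono)
        qed
        show "((\<lambda>y. \<bar>y - x\<bar> * (y - (a + b - x))\<^sup>2 * K) \<longlongrightarrow> 0) (at x)"
          by (auto intro!: tendsto_eq_intros)
      qed
      then show ?thesis unfolding has_field_derivative_iff zero(2) .
    qed
  qed
  then show ?thesis by blast
qed

lemma bump_in_test_functions: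
  assumes "c > 0" "a < b"
  shows "bump a b c p k \<in> test_functions"
proof -
  have "\<exists>p' k'. (deriv ^^ j) (bump a b c p k) = bump a b c p' k'" for j
  proof (induction j)
    case (Suc j)
    then obtain p' k' where *: "(deriv ^^ j) (bump a b c p k) = bump a b c p' k'" by blast
    obtain p'' where "\<forall>x. (bump a b c p' k' has_real_derivative bump a b c p'' (k' + 2) x) (at x)"
      using bump_has_derivative[OF assms] by blast
    then have "deriv (bump a b c p' k') = bump a b c p'' (k' + 2)"
      by (auto intro: DERIV_imp_deriv)
    then show ?case using * by auto
  qed auto
  then have "(deriv ^^ j) (bump a b c p k) differentiable (at x)" for j x
    using bump_has_derivative[OF assms] by (metis real_differentiable_def)
  moreover have "{x. bump a b c p k x \<noteq> 0} \<subseteq> {a..b}" by (auto simp: bump_def)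
  then have "compact (closure {x. bump a b c p k x \<noteq> 0})"
    by (meson bounded_closed_interval bounded_subset compact_closure)
  ultimately show ?thesis by (simp add: test_functions_def)
qed

text \<open>
  Locally, the positive and the negative part of \<open>h\<close> are densities of finite measures that agree on
  all half-lines, hence on all Borel sets.
\<close>
lemma AE_eq_0_if_interval_integrals_eq_0:
  fixes h :: "real \<Rightarrow> real"
  assumes int: "\<And>a b. set_integrable lborel {a<..<b} h"
    and zero: "\<And>a b. a < b \<Longrightarrow> (LINT x:{a<..<b}|lborel. h x) = 0"
  shows "AE x in lborel. h x = 0"
proof -
  \<comment> \<open>The restriction to bounded intervals makes both measures finite.\<close>
  have local: "AE x in lborel. indicator {-real N<..<real N} x * h x = 0" for N
  proof -
    let ?I = "{-real N<..<real N}"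
    let ?h = "\<lambda>x. indicator ?I x * h x"
    have i: "integrable lborel ?h" using int[of "-real N" "real N"] by (simp add: set_integrable_def)
    have [measurable]: "?h \<in> borel_measurable borel"
      using borel_measurable_integrable[OF i] by simp
    define P where "P x = ennreal (max 0 (?h x))" for x
    define Q where "Q x = ennreal (max 0 (- ?h x))" for x
    have [measurable]: "P \<in> borel_measurable borel" "Q \<in> borel_measurable borel"
      unfolding P_def Q_def by measurable
    have Pint: "(\<integral>\<^sup>+x. P x * indicator A x \<partial>lborel) = ennreal (LINT x:A|lborel. max 0 (?h x))"
       and Qint: "(\<integral>\<^sup>+x. Q x * indicator A x \<partial>lborel) = ennreal (LINT x:A|lborel. max 0 (- ?h x))"
       and ints: "set_integrable lborel A (\<lambda>x. max 0 (?h x))" "set_integrable lborel A (\<lambda>x. max 0 (- ?h x))"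
       if [measurable]: "A \<in> sets borel" for A
    proof -
      have i2: "integrable lborel (\<lambda>x. max 0 (?h x))" "integrable lborel (\<lambda>x. max 0 (- ?h x))"
        using i by auto
      show ii: "set_integrable lborel A (\<lambda>x. max 0 (?h x))" "set_integrable lborel A (\<lambda>x. max 0 (- ?h x))"
        unfolding set_integrable_def using i2 that by (intro integrable_mult_indicator; simp)+
      have "(\<integral>\<^sup>+x. P x * indicator A x \<partial>lborel) = (\<integral>\<^sup>+x. ennreal (indicator A x *\<^sub>R max 0 (?h x)) \<partial>lborel)"
        by (intro nn_integral_cong) (auto simp: P_def indicator_def)
      also have "\<dots> = ennreal (LINT x:A|lborel. max 0 (?h x))"
        unfolding set_lebesgue_integral_def using ii unfolding set_integrable_def
        by (intro nn_integral_eq_integral) auto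
      finally show "(\<integral>\<^sup>+x. P x * indicator A x \<partial>lborel) = ennreal (LINT x:A|lborel. max 0 (?h x))" .
      have "(\<integral>\<^sup>+x. Q x * indicator A x \<partial>lborel) = (\<integral>\<^sup>+x. ennreal (indicator A x *\<^sub>R max 0 (- ?h x)) \<partial>lborel)"
        by (intro nn_integral_cong) (auto simp: Q_def indicator_def)
      also have "\<dots> = ennreal (LINT x:A|lborel. max 0 (- ?h x))"
        unfolding set_lebesgue_integral_def using ii unfolding set_integrable_def
        by (intro nn_integral_eq_integral) auto
      finally show "(\<integral>\<^sup>+x. Q x * indicator A x \<partial>lborel) = ennreal (LINT x:A|lborel. max 0 (- ?h x))" .
    qed
    have same: "(LINT y:{x<..}|lborel. max 0 (?h y)) = (LINT y:{x<..}|lborel. max 0 (- ?h y))" for x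
    proof -
      have "(LINT y:{x<..}|lborel. max 0 (?h y)) - (LINT y:{x<..}|lborel. max 0 (- ?h y))
          = (LINT y:{x<..}|lborel. max 0 (?h y) - max 0 (- ?h y))"
        by (subst set_integral_diff) (use ints[of "{x<..}"] in auto)
      also have "\<dots> = (LINT y:{max x (-real N)<..<real N}|lborel. h y)"
        unfolding set_lebesgue_integral_def by (intro Bochner_Integration.integral_cong) (auto simp: indicator_def)
      also have "\<dots> = 0"
      proof (cases "max x (-real N) < real N")
        case False
        then have "{max x (-real N)<..<real N} = {}" by auto
        then show ?thesis by (simp only:) (simp add: set_lebesgue_integral_def)
      qed (rule zero)
      finally show ?thesis by simp
    qed
    have "density lborel P = density lborel Q"
    proof (rule measure_eqI_lessThan)
      fix x :: real
      show "emeasure (density lborel P) {x<..} = emeasure (density lborel Q) {x<..}"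
        by (simp add: emeasure_density Pint Qint same)
      show "emeasure (density lborel P) {x<..} < \<infinity>"
        by (simp add: emeasure_density Pint)
    qed auto
    moreover have "integral\<^sup>N lborel P \<noteq> \<infinity>"
      using Pint[of UNIV] by simp
    ultimately have "AE x in lborel. P x = Q x"
      by (subst (asm) finite_density_unique) auto
    then show ?thesis
      by eventually_elim (auto simp: P_def Q_def max_def split: if_splits)
  qed
  have "AE x in lborel. \<forall>N. indicator {-real N<..<real N} x * h x = 0"
    unfolding AE_all_countable using local by blast
  then show ?thesis
  proof eventually_elim
    case (elim x)
    obtain N where "\<bar>x\<bar> < real N" using reals_Archimedean2 by blast
    then have "indicator {-real N<..<real N} x = (1::real)" by (auto simp: indicator_def)
    with elim show ?case by (metis mult_1)
  qed
qed

text \<open>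
  The difference of the weak and the classical derivative is orthogonal to all test functions. The
  bumps \<open>exp (- 1 / ((n + 1) (x - a) (b - x)))\<close> increase to the indicator of \<open>(a, b)\<close>, so its integral
  over every interval is zero and the two derivatives agree almost everywhere.
\<close>
lemma sobolev_H1_square_integrable_deriv:
  assumes w: "w \<in> sobolev_H1"
    and d: "\<And>x. (w has_real_derivative w' x) (at x)"
    and c: "continuous_on UNIV w'"
  shows "integrable lborel (\<lambda>x. (w' x)\<^sup>2)"
proof -
  obtain g where g: "g \<in> square_integrable" and
    weak: "\<And>\<phi>. \<phi> \<in> test_functions \<Longrightarrow>
        (LINT x | lborel. w x * deriv \<phi> x) = - (LINT x | lborel. g x * \<phi> x)"
    using w by (auto simp: sobolev_H1_def)
  have g2: "integrable lborel (\<lambda>x. (g x)\<^sup>2)" and [measurable]: "g \<in> borel_measurable borel"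
    using g by (auto simp: square_integrable_def)
  have [measurable]: "w' \<in> borel_measurable borel"
    using c by (simp add: borel_measurable_continuous_onI)
  have gint: "set_integrable lborel {a<..<b} g" for a b
    unfolding set_integrable_def
  proof (rule Bochner_Integration.integrable_bound)
    show "integrable lborel (\<lambda>x. indicator {a<..<b} x + (g x)\<^sup>2)"
      using g2 by (cases "a \<le> b") (auto intro!: Bochner_Integration.integrable_add integrable_real_indicator)
    show "AE x in lborel. norm (indicator {a<..<b} x *\<^sub>R g x) \<le> norm (indicator {a<..<b} x + (g x)\<^sup>2)"
    proof (rule AE_I2)
      fix x
      have "0 \<le> (\<bar>g x\<bar> - 1)\<^sup>2" by simp
      then have "\<bar>g x\<bar> \<le> 1 + (g x)\<^sup>2" by (simp add: power2_eq_square algebra_simps)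
      then show "norm (indicator {a<..<b} x *\<^sub>R g x) \<le> norm (indicator {a<..<b} x + (g x)\<^sup>2)"
        by (auto simp: indicator_def)
    qed
  qed auto
  have w'int: "set_integrable lborel {a<..<b} w'" for a b
    by (rule set_integrable_subset[OF borel_integrable_atLeastAtMost'[of a b]])
       (auto intro: continuous_on_subset[OF c])
  have "(LINT x:{a<..<b}|lborel. g x - w' x) = 0" if ab: "a < b" for a b
  proof -
    let ?\<phi> = "\<lambda>n. bump a b (1 / real (Suc n)) 1 0"
    have orth: "(LINT x|lborel. (g x - w' x) * ?\<phi> n x) = 0" for n
    proof -
      have cpos: "1 / real (Suc n) > 0" by simp
      obtain p where "\<forall>x. (?\<phi> n has_real_derivative bump a b (1 / real (Suc n)) p (0 + 2) x) (at x)"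
        using bump_has_derivative[OF cpos ab] by blast
      then have p: "\<And>x. (?\<phi> n has_real_derivative bump a b (1 / real (Suc n)) p 2 x) (at x)"
        unfolding add_0 by blast
      have dp: "deriv (?\<phi> n) = bump a b (1 / real (Suc n)) p 2"
        using p by (auto intro: DERIV_imp_deriv)
      obtain p2 where p2: "\<forall>x. (bump a b (1 / real (Suc n)) p 2 has_real_derivative
          bump a b (1 / real (Suc n)) p2 (2 + 2) x) (at x)"
        using bump_has_derivative[OF cpos ab] by blast
      have cphi: "continuous_on UNIV (?\<phi> n)" "continuous_on UNIV (bump a b (1 / real (Suc n)) p 2)"
        by (rule continuous_at_imp_continuous_on, use p p2 in \<open>blast intro: DERIV_isCont\<close>)+
      then have [measurable]: "?\<phi> n \<in> borel_measurable borel"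
        by (simp add: borel_measurable_continuous_onI)
      have "(LINT x|lborel. (w x * bump a b (1 / real (Suc n)) p 2 x) * indicator {a..b} x)
          = w b * ?\<phi> n b - w a * ?\<phi> n a - (LINT x|lborel. (w' x * ?\<phi> n x) * indicator {a..b} x)"
        using p ab d c cphi by (intro integral_by_parts) (auto simp: continuous_on_eq_continuous_at)
      also have "\<dots> = - (LINT x|lborel. (w' x * ?\<phi> n x) * indicator {a..b} x)"
        by (simp add: bump_def)
      also have "(LINT x|lborel. (w' x * ?\<phi> n x) * indicator {a..b} x) = (LINT x|lborel. w' x * ?\<phi> n x)"
        by (intro Bochner_Integration.integral_cong) (auto simp: bump_def indicator_def)
      also have "(LINT x|lborel. (w x * bump a b (1 / real (Suc n)) p 2 x) * indicator {a..b} x)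
          = (LINT x|lborel. w x * deriv (?\<phi> n) x)"
        unfolding dp by (intro Bochner_Integration.integral_cong) (auto simp: bump_def indicator_def)
      also have "\<dots> = - (LINT x|lborel. g x * ?\<phi> n x)"
        using bump_in_test_functions ab by (intro weak) auto
      finally have "(LINT x|lborel. g x * ?\<phi> n x) - (LINT x|lborel. w' x * ?\<phi> n x) = 0" by simp
      moreover have "integrable lborel (\<lambda>x. f x * ?\<phi> n x)" 
        if f: "set_integrable lborel {a<..<b} f" and [measurable]: "f \<in> borel_measurable borel" for f
      proof (rule Bochner_Integration.integrable_bound[OF f[unfolded set_integrable_def]])
        show "(\<lambda>x. f x * ?\<phi> n x) \<in> borel_measurable lborel" by measurable
        show "AE x in lborel. norm (f x * ?\<phi> n x) \<le> norm (indicator {a<..<b} x *\<^sub>R f x)"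
          by (intro AE_I2) (auto simp: bump_def abs_mult mult_left_le)
      qed
      ultimately show ?thesis using gint w'int
        by (subst left_diff_distrib, subst Bochner_Integration.integral_diff) auto
    qed
    have "(\<lambda>n. LINT x|lborel. (g x - w' x) * ?\<phi> n x) \<longlonglongrightarrow> (LINT x|lborel. indicator {a<..<b} x *\<^sub>R (g x - w' x))"
    proof (rule integral_dominated_convergence)
      show "integrable lborel (\<lambda>x. \<bar>indicator {a<..<b} x *\<^sub>R (g x - w' x)\<bar>)"
        using set_integral_diff(1)[OF gint w'int] by (auto simp: set_integrable_def)
      show "AE x in lborel. (\<lambda>n. (g x - w' x) * ?\<phi> n x) \<longlonglongrightarrow> indicator {a<..<b} x *\<^sub>R (g x - w' x)"
      proof (intro AE_I2)
        fix x
        have "(\<lambda>n. exp (- (1 / real (Suc n)) * s)) \<longlonglongrightarrow> exp (- 0 * s)" for s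
          by (intro tendsto_intros LIMSEQ_inverse_real_of_nat[unfolded inverse_eq_divide])
        from tendsto_mult[OF tendsto_const[of "g x - w' x"] this[of "inverse ((x - a) * (b - x))"]]
        show "(\<lambda>n. (g x - w' x) * ?\<phi> n x) \<longlonglongrightarrow> indicator {a<..<b} x *\<^sub>R (g x - w' x)"
          by (cases "a < x \<and> x < b") (auto simp: bump_def)
      qed
      show "AE x in lborel. norm ((g x - w' x) * ?\<phi> n x) \<le> \<bar>indicator {a<..<b} x *\<^sub>R (g x - w' x)\<bar>" for n
        by (intro AE_I2) (auto simp: bump_def abs_mult mult_left_le)
      show "(\<lambda>x. indicator {a<..<b} x *\<^sub>R (g x - w' x)) \<in> borel_measurable lborel"
        by measurable
      have "continuous_on UNIV (?\<phi> n)" for n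
        using bump_has_derivative[of "1 / real (Suc n)" a b 1 0] ab
        by (intro continuous_at_imp_continuous_on) (auto intro: DERIV_isCont)
      then have [measurable]: "?\<phi> n \<in> borel_measurable borel" for n
        by (simp only: borel_measurable_continuous_onI)
      show "(\<lambda>x. (g x - w' x) * ?\<phi> n x) \<in> borel_measurable lborel" for n
        by measurable
    qed
    then show ?thesis unfolding orth set_lebesgue_integral_def
      using LIMSEQ_unique tendsto_const by blast
  qed
  then have "AE x in lborel. g x - w' x = 0"
    by (intro AE_eq_0_if_interval_integrals_eq_0 set_integral_diff gint w'int)
  then have "AE x in lborel. (g x)\<^sup>2 = (w' x)\<^sup>2" by eventually_elim auto
  then show ?thesis using g2 by (subst (asm) integrable_cong_AE) auto
qed

section \<open>Decaying Hoelder continuous functions\<close>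

text \<open>
  Polynomial decay with a Hoelder modulus that decays at the same rate; the weight \<open>1 + \<bar>x\<bar>\<close> is
  equivalent to the Japanese bracket and splits more easily under the triangle inequality. For
  \<open>\<rho> = 0\<close> these are the bounded, uniformly locally Hoelder continuous functions.
\<close>
definition holder_decay :: "real \<Rightarrow> real \<Rightarrow> (real \<Rightarrow> real) \<Rightarrow> bool" where
  "holder_decay \<alpha> \<rho> f \<longleftrightarrow> (\<exists>C.
     (\<forall>x. \<bar>f x\<bar> \<le> C * (1 + \<bar>x\<bar>) powr - \<rho>) \<and>
     (\<forall>x t. \<bar>x - t\<bar> \<le> 1 \<longrightarrow> \<bar>f x - f t\<bar> \<le> C * (1 + \<bar>x\<bar>) powr - \<rho> * \<bar>x - t\<bar> powr \<alpha>))"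

lemma holder_decayE:
  assumes "holder_decay \<alpha> \<rho> f"
  obtains C where "C > 0" "\<And>x. \<bar>f x\<bar> \<le> C * (1 + \<bar>x\<bar>) powr - \<rho>"
    "\<And>x t. \<bar>x - t\<bar> \<le> 1 \<Longrightarrow> \<bar>f x - f t\<bar> \<le> C * (1 + \<bar>x\<bar>) powr - \<rho> * \<bar>x - t\<bar> powr \<alpha>"
proof -
  obtain C where C: "\<And>x. \<bar>f x\<bar> \<le> C * (1 + \<bar>x\<bar>) powr - \<rho>"
    "\<And>x t. \<bar>x - t\<bar> \<le> 1 \<Longrightarrow> \<bar>f x - f t\<bar> \<le> C * (1 + \<bar>x\<bar>) powr - \<rho> * \<bar>x - t\<bar> powr \<alpha>"
    using assms by (auto simp: holder_decay_def)
  have le: "C \<le> max C 1" by simp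
  show thesis
  proof (rule that[of "max C 1"])
    show "max C 1 > 0" by simp
    show "\<bar>f x\<bar> \<le> max C 1 * (1 + \<bar>x\<bar>) powr - \<rho>" for x
      using C(1)[of x] mult_right_mono[OF le, of "(1 + \<bar>x\<bar>) powr - \<rho>"] by simp
    show "\<bar>f x - f t\<bar> \<le> max C 1 * (1 + \<bar>x\<bar>) powr - \<rho> * \<bar>x - t\<bar> powr \<alpha>" if "\<bar>x - t\<bar> \<le> 1" for x t
      using C(2)[OF that] mult_right_mono[OF le, of "(1 + \<bar>x\<bar>) powr - \<rho> * \<bar>x - t\<bar> powr \<alpha>"]
      by (simp add: mult.assoc)
  qed
qed

lemma holder_decay_continuous:
  assumes f: "holder_decay \<alpha> \<rho> f" and "\<alpha> > 0"
  shows "continuous_on UNIV f"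
proof (rule continuous_at_imp_continuous_on, rule ballI)
  fix x
  obtain C where C: "C > 0" "\<And>x t. \<bar>x - t\<bar> \<le> 1 \<Longrightarrow> \<bar>f x - f t\<bar> \<le> C * (1 + \<bar>x\<bar>) powr - \<rho> * \<bar>x - t\<bar> powr \<alpha>"
    using holder_decayE[OF f] by metis
  have "((\<lambda>t. f t - f x) \<longlongrightarrow> 0) (at x)"
  proof (rule Lim_null_comparison)
    have "\<forall>\<^sub>F t in at x. \<bar>x - t\<bar> \<le> 1"
      unfolding eventually_at by (intro exI[of _ 1]) (auto simp: dist_real_def)
    then show "\<forall>\<^sub>F t in at x. norm (f t - f x) \<le> C * (1 + \<bar>x\<bar>) powr - \<rho> * \<bar>x - t\<bar> powr \<alpha>"
      by eventually_elim (use C(2) in \<open>simp add: abs_minus_commute[of "f _" "f x"]\<close>)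
    have "((\<lambda>t. \<bar>x - t\<bar> powr \<alpha>) \<longlongrightarrow> \<bar>x - x\<bar> powr \<alpha>) (at x)"
      using assms(2) by (intro tendsto_powr' tendsto_intros) auto
    then show "((\<lambda>t. C * (1 + \<bar>x\<bar>) powr - \<rho> * \<bar>x - t\<bar> powr \<alpha>) \<longlongrightarrow> 0) (at x)"
      by (auto intro!: tendsto_mult_right_zero)
  qed
  then show "isCont f x" by (simp add: isCont_def LIM_zero_iff)
qed

lemma holder_decay_measurable:
  assumes "holder_decay \<alpha> \<rho> f" "\<alpha> > 0"
  shows "f \<in> borel_measurable borel"
  using holder_decay_continuous[OF assms] by (rule borel_measurable_continuous_onI)

lemma holder_decay_mult:
  assumes f: "holder_decay \<alpha> \<rho> f" and "\<alpha> \<le> 1"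
    and B: "\<And>x. \<bar>u x\<bar> \<le> B" and L: "\<And>x t. \<bar>u x - u t\<bar> \<le> L * \<bar>x - t\<bar>"
  shows "holder_decay \<alpha> \<rho> (\<lambda>x. u x * f x)"
proof -
  obtain C where C: "C > 0" "\<And>x. \<bar>f x\<bar> \<le> C * (1 + \<bar>x\<bar>) powr - \<rho>"
    "\<And>x t. \<bar>x - t\<bar> \<le> 1 \<Longrightarrow> \<bar>f x - f t\<bar> \<le> C * (1 + \<bar>x\<bar>) powr - \<rho> * \<bar>x - t\<bar> powr \<alpha>"
    using holder_decayE[OF f] by metis
  have "B \<ge> 0" using B[of 0] by linarith
  have "L \<ge> 0" using L[of 0 1] by simp
  show ?thesis unfolding holder_decay_def
  proof (intro exI[of _ "(B + L) * C"] conjI allI impI)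
    fix x
    have "\<bar>u x * f x\<bar> \<le> B * (C * (1 + \<bar>x\<bar>) powr - \<rho>)"
      unfolding abs_mult using B[of x] C(2)[of x] by (intro mult_mono) auto
    also have "\<dots> \<le> (B + L) * (C * (1 + \<bar>x\<bar>) powr - \<rho>)"
      using C(1) \<open>L \<ge> 0\<close> by (intro mult_right_mono) auto
    finally show "\<bar>u x * f x\<bar> \<le> (B + L) * C * (1 + \<bar>x\<bar>) powr - \<rho>" by (simp add: mult.assoc)
    fix t assume le: "\<bar>x - t\<bar> \<le> 1"
    have "\<bar>x - t\<bar> \<le> \<bar>x - t\<bar> powr \<alpha>"
      using powr_mono'[OF assms(2), of "\<bar>x - t\<bar>"] le by (cases "x = t") auto
    then have lip: "\<bar>u x - u t\<bar> \<le> L * \<bar>x - t\<bar> powr \<alpha>"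
      using L[of x t] \<open>L \<ge> 0\<close> by (meson mult_left_mono order_trans)
    have "u x * f x - u t * f t = (u x - u t) * f x + u t * (f x - f t)" by (simp add: algebra_simps)
    then have "\<bar>u x * f x - u t * f t\<bar> \<le> \<bar>u x - u t\<bar> * \<bar>f x\<bar> + \<bar>u t\<bar> * \<bar>f x - f t\<bar>"
      by (metis abs_mult abs_triangle_ineq)
    also have "\<dots> \<le> (L * \<bar>x - t\<bar> powr \<alpha>) * (C * (1 + \<bar>x\<bar>) powr - \<rho>)
        + B * (C * (1 + \<bar>x\<bar>) powr - \<rho> * \<bar>x - t\<bar> powr \<alpha>)"
      using lip C(2)[of x] B[of t] C(3)[OF le] \<open>L \<ge> 0\<close> \<open>B \<ge> 0\<close> C(1) by (intro add_mono mult_mono) auto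
    also have "\<dots> = (B + L) * C * (1 + \<bar>x\<bar>) powr - \<rho> * \<bar>x - t\<bar> powr \<alpha>"
      by (simp add: algebra_simps)
    finally show "\<bar>u x * f x - u t * f t\<bar> \<le> (B + L) * C * (1 + \<bar>x\<bar>) powr - \<rho> * \<bar>x - t\<bar> powr \<alpha>" .
  qed
qed

lemma SUP_ennreal_finite_imp_bounded:
  assumes "(SUP x\<in>A. ennreal (F x)) < \<infinity>"
  shows "\<exists>M\<ge>0. \<forall>x\<in>A. F x \<le> M"
proof -
  obtain M where M: "M \<ge> 0" "(SUP x\<in>A. ennreal (F x)) = ennreal M"
    using assms by (cases "SUP x\<in>A. ennreal (F x)") auto
  have "F x \<le> M" if "x \<in> A" for x
    using SUP_upper[OF that, of "\<lambda>x. ennreal (F x)"] M by (simp add: ennreal_le_iff)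
  with M(1) show ?thesis by blast
qed

text \<open>
  The weights are compared by the bound \<open>(1 + \<bar>x\<bar>) / 2\<close> for the Japanese bracket from below.
\<close>
lemma weighted_holder_spaceD:
  assumes w: "w \<in> weighted_holder_space 1 \<alpha> \<rho>" and "\<rho> \<ge> 0"
  shows "(w has_real_derivative deriv w x) (at x)"
    and "holder_decay \<alpha> \<rho> (deriv w)"
    and "\<exists>C. \<forall>x. \<bar>w x\<bar> \<le> C * (1 + \<bar>x\<bar>) powr - \<rho>"
proof -
  have "w differentiable (at x)" using w by (simp add: weighted_holder_space_def)
  then show "(w has_real_derivative deriv w x) (at x)"
    using DERIV_deriv_iff_real_differentiable by blast
  have weight: "v \<le> M * 2 powr \<rho> * (1 + \<bar>x\<bar>) powr - \<rho>"
    if "japanese_bracket x powr \<rho> * v \<le> M" "v \<ge> 0" for x v M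
  proof -
    have "((1 + \<bar>x\<bar>) / 2)\<^sup>2 \<le> 1 + x\<^sup>2"
    proof -
      have "0 \<le> (1 - \<bar>x\<bar>)\<^sup>2 + 2 + 2 * x\<^sup>2" by simp
      then show ?thesis by (simp add: power2_eq_square algebra_simps abs_mult_self_eq)
    qed
    then have "(1 + \<bar>x\<bar>) / 2 \<le> sqrt (1 + x\<^sup>2)" by (rule real_le_rsqrt)
    also have "\<dots> = japanese_bracket x" by (simp add: japanese_bracket_def powr_half_sqrt)
    finally have "((1 + \<bar>x\<bar>) / 2) powr \<rho> \<le> japanese_bracket x powr \<rho>"
      using \<open>\<rho> \<ge> 0\<close> by (intro powr_mono2) auto
    then have "((1 + \<bar>x\<bar>) / 2) powr \<rho> * v \<le> M" using that by (meson mult_right_mono order_trans)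
    moreover have "((1 + \<bar>x\<bar>) / 2) powr \<rho> = (1 + \<bar>x\<bar>) powr \<rho> / 2 powr \<rho>"
      by (simp add: powr_divide)
    ultimately show ?thesis by (simp add: powr_minus field_simps add_pos_nonneg)
  qed
  define N0 where "N0 = (SUP x. ennreal (japanese_bracket x powr \<rho> * \<bar>w x\<bar>))"
  define N1 where "N1 = (SUP x. ennreal (japanese_bracket x powr \<rho> * \<bar>deriv w x\<bar>))"
  define N2 where "N2 = (SUP x. SUP t \<in> {t. \<bar>x - t\<bar> \<le> 1}. ennreal (japanese_bracket x powr \<rho>
            * (\<bar>deriv w x - deriv w t\<bar> / \<bar>x - t\<bar> powr \<alpha>)))"
  have "weighted_holder_norm 1 \<alpha> \<rho> w = N0 + N1 + N2"
    unfolding weighted_holder_norm_def N0_def N1_def N2_def One_nat_def sum.atMost_Suc atMost_0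
    by simp
  moreover have "weighted_holder_norm 1 \<alpha> \<rho> w < \<infinity>"
    using w unfolding weighted_holder_space_def by blast
  ultimately have n0: "N0 < \<infinity>" and n1: "N1 < \<infinity>" and n2: "N2 < \<infinity>"
    by simp_all
  obtain M0 where M0: "\<And>x. japanese_bracket x powr \<rho> * \<bar>w x\<bar> \<le> M0"
    using SUP_ennreal_finite_imp_bounded[OF n0[unfolded N0_def]] by auto
  obtain M1 where M1: "M1 \<ge> 0" "\<And>x. japanese_bracket x powr \<rho> * \<bar>deriv w x\<bar> \<le> M1"
    using SUP_ennreal_finite_imp_bounded[OF n1[unfolded N1_def]] by auto
  obtain M2 where M2: "M2 \<ge> 0" "N2 = ennreal M2" using n2 by (cases N2) auto
  have M2_bound: "japanese_bracket x powr \<rho> * (\<bar>deriv w x - deriv w t\<bar> / \<bar>x - t\<bar> powr \<alpha>) \<le> M2"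
    if "\<bar>x - t\<bar> \<le> 1" for x t
  proof -
    have "ennreal (japanese_bracket x powr \<rho> * (\<bar>deriv w x - deriv w t\<bar> / \<bar>x - t\<bar> powr \<alpha>)) \<le> N2"
      unfolding N2_def using that by (intro SUP_upper2[of x] SUP_upper) auto
    then show ?thesis using M2 by (simp only: ennreal_le_iff)
  qed
  show "\<exists>C. \<forall>x. \<bar>w x\<bar> \<le> C * (1 + \<bar>x\<bar>) powr - \<rho>"
    using weight[OF M0] by auto
  show "holder_decay \<alpha> \<rho> (deriv w)"
    unfolding holder_decay_def
  proof (intro exI[of _ "(M1 + M2) * 2 powr \<rho>"] conjI allI impI)
    have le: "M1 * 2 powr \<rho> * (1 + \<bar>x\<bar>) powr - \<rho> \<le> (M1 + M2) * 2 powr \<rho> * (1 + \<bar>x\<bar>) powr - \<rho>"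
      "M2 * 2 powr \<rho> * (1 + \<bar>x\<bar>) powr - \<rho> \<le> (M1 + M2) * 2 powr \<rho> * (1 + \<bar>x\<bar>) powr - \<rho>" for x
      using M1(1) M2(1) by (intro mult_right_mono; simp)+
    show "\<bar>deriv w x\<bar> \<le> (M1 + M2) * 2 powr \<rho> * (1 + \<bar>x\<bar>) powr - \<rho>" for x
      by (rule order_trans[OF weight[OF M1(2) abs_ge_zero] le(1)])
    fix x t :: real assume "\<bar>x - t\<bar> \<le> 1"
    show "\<bar>deriv w x - deriv w t\<bar> \<le> (M1 + M2) * 2 powr \<rho> * (1 + \<bar>x\<bar>) powr - \<rho> * \<bar>x - t\<bar> powr \<alpha>"
    proof (cases "x = t")
      case False
      have "\<bar>deriv w x - deriv w t\<bar> / \<bar>x - t\<bar> powr \<alpha> \<le> (M1 + M2) * 2 powr \<rho> * (1 + \<bar>x\<bar>) powr - \<rho>"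
        by (rule order_trans[OF weight[OF M2_bound[OF \<open>\<bar>x - t\<bar> \<le> 1\<close>]] le(2)]) simp
      then show ?thesis using False by (simp add: pos_divide_le_eq)
    qed simp
  qed
qed

section \<open>Integrability of powers\<close>

lemma nonneg_has_integral_imp_set_integrable:
  fixes f :: "real \<Rightarrow> real"
  assumes "(f has_integral I) A" "\<And>x. x \<in> A \<Longrightarrow> f x \<ge> 0" "f \<in> borel_measurable borel" "A \<in> sets borel"
  shows "set_integrable lborel A f"
proof -
  have "f absolutely_integrable_on A"
    using assms(1,2) by (intro nonnegative_absolutely_integrable_1) auto
  then have "integrable (completion lborel) (\<lambda>x. indicator A x *\<^sub>R f x)"
    by (simp add: set_integrable_def)
  then show ?thesis using assms(3,4)
    by (subst (asm) integrable_completion) (auto simp: set_integrable_def)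
qed

lemma integrable_powr_weight:
  assumes "\<rho> > 1"
  shows "integrable lborel (\<lambda>x::real. (1 + \<bar>x\<bar>) powr - \<rho>)"
proof -
  have "((\<lambda>x. x powr - \<rho>) has_integral - (1 powr (- \<rho> + 1)) / (- \<rho> + 1)) {1..}"
    using assms by (intro has_integral_powr_to_inf) auto
  then have "set_integrable lborel {1..} (\<lambda>x. x powr - \<rho>)"
    by (rule nonneg_has_integral_imp_set_integrable) auto
  then have i: "integrable lborel (\<lambda>x. indicator {1..} x * x powr - \<rho>)"
    by (simp add: set_integrable_def)
  have "integrable lborel (\<lambda>x. indicator {1..} (1 + 1 * x) * (1 + 1 * x) powr - \<rho>
      + indicator {1..} (1 + (- 1) * x) * (1 + (- 1) * x) powr - \<rho>)"
    by (intro Bochner_Integration.integrable_add lborel_integrable_real_affine[OF i]) auto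
  then show ?thesis
    by (rule Bochner_Integration.integrable_bound) (auto intro!: AE_I2 simp: indicator_def)
qed

lemma set_integrable_inverse_square:
  assumes "\<delta> > 0"
  shows "set_integrable lborel {\<delta><..} (\<lambda>s::real. 1 / s\<^sup>2)"
proof -
  have "((\<lambda>x. x powr - 2) has_integral - (\<delta> powr (- 2 + 1)) / (- 2 + 1)) {\<delta>..}"
    using assms by (intro has_integral_powr_to_inf) auto
  then have "set_integrable lborel {\<delta>..} (\<lambda>x. x powr - 2)"
    by (rule nonneg_has_integral_imp_set_integrable) auto
  then have "set_integrable lborel {\<delta><..} (\<lambda>x. x powr - 2)"
    by (rule set_integrable_subset) auto
  then show ?thesis
    by (rule set_integrable_cong[THEN iffD1, rotated -1])
       (use assms in \<open>auto simp: powr_minus powr_numeral divide_inverse\<close>)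
qed

lemma set_integrable_powr_near_0:
  assumes "\<alpha> > 0"
  shows "set_integrable lborel {0<..1} (\<lambda>s::real. s powr (\<alpha> - 1))"
proof -
  have "((\<lambda>x. x powr (\<alpha> - 1)) has_integral (1 powr (\<alpha> - 1 + 1) / (\<alpha> - 1 + 1))) {0..1::real}"
    using assms by (intro has_integral_powr_from_0) auto
  then have "set_integrable lborel {0..1} (\<lambda>x::real. x powr (\<alpha> - 1))"
    by (rule nonneg_has_integral_imp_set_integrable) auto
  then show ?thesis by (rule set_integrable_subset) auto
qed

lemma weight_le_1:
  assumes "\<rho> \<ge> 0"
  shows "(1 + \<bar>x::real\<bar>) powr - \<rho> \<le> 1"
  using powr_mono[of "- \<rho>" 0 "1 + \<bar>x\<bar>"] assms by (simp split: if_splits)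

lemma one_plus_abs_mult_weight_le_1:
  assumes "\<rho> \<ge> 1"
  shows "(1 + \<bar>x::real\<bar>) * (1 + \<bar>x\<bar>) powr - \<rho> \<le> 1"
proof -
  have "(1 + \<bar>x\<bar>) * (1 + \<bar>x\<bar>) powr - \<rho> = (1 + \<bar>x\<bar>) powr - (\<rho> - 1)"
    by (simp add: powr_diff powr_minus divide_inverse)
  also have "\<dots> \<le> 1" using assms by (intro weight_le_1) simp
  finally show ?thesis .
qed

lemma holder_decay_integrable:
  assumes f: "holder_decay \<alpha> \<rho> f" and "\<alpha> > 0" "\<rho> > 1"
  shows "integrable lborel f" and "integrable lborel (\<lambda>x. (f x)\<^sup>2)"
proof -
  have [measurable]: "f \<in> borel_measurable borel" using holder_decay_measurable[OF f \<open>\<alpha> > 0\<close>] .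
  obtain C where C: "C > 0" "\<And>x. \<bar>f x\<bar> \<le> C * (1 + \<bar>x\<bar>) powr - \<rho>"
    using holder_decayE[OF f] by metis
  have i: "integrable lborel (\<lambda>x. K * (1 + \<bar>x\<bar>) powr - \<rho>)" for K
    using integrable_powr_weight[OF \<open>\<rho> > 1\<close>] by simp
  show "integrable lborel f"
    by (rule Bochner_Integration.integrable_bound[OF i[of C]]) (use C in \<open>auto intro!: AE_I2\<close>)
  show "integrable lborel (\<lambda>x. (f x)\<^sup>2)"
  proof (rule Bochner_Integration.integrable_bound[OF i[of "C * C"]])
    show "AE x in lborel. norm ((f x)\<^sup>2) \<le> norm (C * C * (1 + \<bar>x\<bar>) powr - \<rho>)"
    proof (rule AE_I2)
      fix x :: real
      have "C * (1 + \<bar>x\<bar>) powr - \<rho> \<le> C"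
        using weight_le_1[of \<rho> x] \<open>\<rho> > 1\<close> C(1) by simp
      then have "\<bar>f x\<bar> \<le> C" using C(2)[of x] by linarith
      then have "\<bar>f x\<bar> * \<bar>f x\<bar> \<le> C * (C * (1 + \<bar>x\<bar>) powr - \<rho>)"
        using C(2)[of x] C(1) by (intro mult_mono) auto
      then show "norm ((f x)\<^sup>2) \<le> norm (C * C * (1 + \<bar>x\<bar>) powr - \<rho>)"
        using C(1) by (simp add: power2_eq_square abs_mult mult.assoc)
    qed
  qed auto
qed

section \<open>The principal value as an absolutely convergent integral\<close>

text \<open>
  Folding the two half-lines \<open>t < x\<close> and \<open>t > x\<close> onto \<open>s = \<bar>x - t\<bar>\<close> builds the cancellation of the
  principal value into the integrand.
\<close>
definition pv_kernel :: "(real \<Rightarrow> real) \<Rightarrow> real \<Rightarrow> real \<Rightarrow> real" where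
  "pv_kernel f x s = (f (x - s) - f (x + s)) / s"

lemma pv_kernel_near_0:
  assumes f: "\<And>x t. \<bar>x - t\<bar> \<le> 1 \<Longrightarrow> \<bar>f x - f t\<bar> \<le> C * (1 + \<bar>x\<bar>) powr - \<rho> * \<bar>x - t\<bar> powr \<alpha>"
    and s: "0 < s" "s \<le> 1"
  shows "\<bar>pv_kernel f x s\<bar> \<le> 2 * C * (1 + \<bar>x\<bar>) powr - \<rho> * s powr (\<alpha> - 1)"
proof -
  have "\<bar>f (x - s) - f (x + s)\<bar> \<le> \<bar>f x - f (x - s)\<bar> + \<bar>f x - f (x + s)\<bar>" by linarith
  also have "\<dots> \<le> 2 * (C * (1 + \<bar>x\<bar>) powr - \<rho> * s powr \<alpha>)"
    using f[of x "x - s"] f[of x "x + s"] s by simp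
  finally have "\<bar>pv_kernel f x s\<bar> \<le> 2 * (C * (1 + \<bar>x\<bar>) powr - \<rho> * s powr \<alpha>) / s"
    using s by (simp add: pv_kernel_def divide_right_mono)
  also have "\<dots> = 2 * C * (1 + \<bar>x\<bar>) powr - \<rho> * s powr (\<alpha> - 1)"
    using s by (simp add: powr_diff)
  finally show ?thesis .
qed

text \<open>
  By \<open>\<bar>y / s\<bar> \<le> y\<^sup>2 + 1 / s\<^sup>2\<close>. This is where square integrability controls the Hilbert transform at
  infinity.
\<close>
lemma truncated_integrable:
  fixes f :: "real \<Rightarrow> real"
  assumes [measurable]: "f \<in> borel_measurable borel" and f2: "integrable lborel (\<lambda>x. (f x)\<^sup>2)"
    and "\<delta> > 0" "c \<noteq> 0"
  shows "set_integrable lborel {\<delta><..} (\<lambda>s. f (x + c * s) / s)"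
  unfolding set_integrable_def
proof (rule Bochner_Integration.integrable_bound)
  show "integrable lborel (\<lambda>s. (f (x + c * s))\<^sup>2 + indicator {\<delta><..} s *\<^sub>R (1 / s\<^sup>2))"
    using set_integrable_inverse_square[OF \<open>\<delta> > 0\<close>] lborel_integrable_real_affine[OF f2 \<open>c \<noteq> 0\<close>]
    by (intro Bochner_Integration.integrable_add) (auto simp: set_integrable_def)
  show "AE s in lborel. norm (indicator {\<delta><..} s *\<^sub>R (f (x + c * s) / s))
      \<le> norm ((f (x + c * s))\<^sup>2 + indicator {\<delta><..} s *\<^sub>R (1 / s\<^sup>2))"
  proof (rule AE_I2)
    fix s
    have "\<bar>y / s\<bar> \<le> y\<^sup>2 + 1 / s\<^sup>2" for y :: real
    proof -
      have "0 \<le> (\<bar>y\<bar> - \<bar>1 / s\<bar>)\<^sup>2" by simp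
      then have "2 * \<bar>y / s\<bar> \<le> y\<^sup>2 + (1 / s)\<^sup>2"
        unfolding power2_diff power2_abs by (simp add: abs_mult divide_inverse)
      also have "\<dots> \<le> 2 * (y\<^sup>2 + (1 / s)\<^sup>2)" by simp
      finally show ?thesis by (simp add: power_divide)
    qed
    then show "norm (indicator {\<delta><..} s *\<^sub>R (f (x + c * s) / s))
      \<le> norm ((f (x + c * s))\<^sup>2 + indicator {\<delta><..} s *\<^sub>R (1 / s\<^sup>2))"
      by (auto simp: indicator_def)
  qed
qed auto

text \<open>
  Substitute \<open>t = x - s\<close> and reflect the part with \<open>s < 0\<close>.
\<close>
lemma truncated_hilbert_integral:
  fixes f :: "real \<Rightarrow> real"
  assumes f: "f \<in> borel_measurable borel" and f2: "integrable lborel (\<lambda>x. (f x)\<^sup>2)"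
    and "\<delta> > 0"
  shows "set_integrable lborel {\<delta><..} (pv_kernel f x)"
    and "(LINT t : {t. \<bar>x - t\<bar> > \<delta>} | lborel. f t / (x - t)) = (LINT s : {\<delta><..} | lborel. pv_kernel f x s)"
proof -
  note [measurable] = f
  have m: "set_integrable lborel {\<delta><..} (\<lambda>s. f (x - s) / s)"
    and p: "set_integrable lborel {\<delta><..} (\<lambda>s. f (x + s) / s)"
    using truncated_integrable[OF f f2 \<open>\<delta> > 0\<close>, of "-1" x] truncated_integrable[OF f f2 \<open>\<delta> > 0\<close>, of 1 x]
    by simp_all
  have eq: "pv_kernel f x = (\<lambda>s. f (x - s) / s - f (x + s) / s)"
    by (auto simp: pv_kernel_def diff_divide_distrib)
  show "set_integrable lborel {\<delta><..} (pv_kernel f x)"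
    unfolding eq using m p by (rule set_integral_diff)
  define h where "h = (\<lambda>s. f (x - s) / s)"
  have "(LINT t : {t. \<bar>x - t\<bar> > \<delta>} | lborel. f t / (x - t))
      = (LINT s|lborel. indicator {s. \<bar>s\<bar> > \<delta>} s * h s)"
    unfolding set_lebesgue_integral_def h_def
    by (subst lborel_integral_real_affine[where c = "-1" and t = x]) (auto simp: indicator_def)
  also have "\<dots> = (LINT s|lborel. indicator {\<delta><..} s *\<^sub>R h s + indicator {..<-\<delta>} s *\<^sub>R h s)"
    using \<open>\<delta> > 0\<close> by (intro Bochner_Integration.integral_cong) (auto simp: indicator_def)
  also have "\<dots> = (LINT s|lborel. indicator {\<delta><..} s *\<^sub>R h s) + (LINT s|lborel. indicator {..<-\<delta>} s *\<^sub>R h s)"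
  proof (rule Bochner_Integration.integral_add)
    show "integrable lborel (\<lambda>s. indicator {\<delta><..} s *\<^sub>R h s)"
      using m by (simp add: set_integrable_def h_def)
    have "integrable lborel (\<lambda>s. indicator {..<-\<delta>} (0 + (-1) * s) *\<^sub>R h (0 + (-1) * s))"
      using integrable_minus[OF p[unfolded set_integrable_def]]
      by (rule Bochner_Integration.integrable_cong[THEN iffD1, rotated -1])
         (auto simp: indicator_def h_def)
    then show "integrable lborel (\<lambda>s. indicator {..<-\<delta>} s *\<^sub>R h s)"
      by (subst (asm) lborel_integrable_real_affine_iff) auto
  qed
  also have "(LINT s|lborel. indicator {..<-\<delta>} s *\<^sub>R h s) = - (LINT s:{\<delta><..}|lborel. f (x + s) / s)"
    unfolding set_lebesgue_integral_def
    by (subst lborel_integral_real_affine[where c = "-1" and t = 0])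
       (auto simp: indicator_def h_def simp flip: Bochner_Integration.integral_minus intro!: Bochner_Integration.integral_cong)
  also have "(LINT s|lborel. indicator {\<delta><..} s *\<^sub>R h s) = (LINT s:{\<delta><..}|lborel. f (x - s) / s)"
    by (simp add: set_lebesgue_integral_def h_def)
  also have "(LINT s:{\<delta><..}|lborel. f (x - s) / s) + - (LINT s:{\<delta><..}|lborel. f (x + s) / s)
      = (LINT s : {\<delta><..} | lborel. pv_kernel f x s)"
    unfolding eq using set_integral_diff(2)[OF m p] by simp
  finally show "(LINT t : {t. \<bar>x - t\<bar> > \<delta>} | lborel. f t / (x - t)) = (LINT s : {\<delta><..} | lborel. pv_kernel f x s)" .
qed

text \<open>
  The folded kernel is \<open>O (s powr (\<alpha> - 1))\<close> near \<open>0\<close> by Hoelder continuity, so the limit of vanishing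
  truncation exists by dominated convergence.
\<close>
lemma hilbert_transform_eq_pv:
  assumes f: "holder_decay \<alpha> \<rho> f" and "\<alpha> > 0" and f2: "integrable lborel (\<lambda>x. (f x)\<^sup>2)"
  shows "set_integrable lborel {0<..} (pv_kernel f x)"
    and "hilbert_transform f x = (1 / pi) * (LINT s : {0<..} | lborel. pv_kernel f x s)"
proof -
  have fm[measurable]: "f \<in> borel_measurable borel"
    using holder_decay_measurable[OF f \<open>\<alpha> > 0\<close>] .
  have [measurable]: "pv_kernel f x \<in> borel_measurable borel"
    unfolding pv_kernel_def by measurable
  obtain C where C: "C > 0"
    "\<And>x t. \<bar>x - t\<bar> \<le> 1 \<Longrightarrow> \<bar>f x - f t\<bar> \<le> C * (1 + \<bar>x\<bar>) powr - \<rho> * \<bar>x - t\<bar> powr \<alpha>"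
    using holder_decayE[OF f] by metis
  define K where "K = 2 * C * (1 + \<bar>x\<bar>) powr - \<rho>"
  have near: "\<bar>pv_kernel f x s\<bar> \<le> K * s powr (\<alpha> - 1)" if "0 < s" "s \<le> 1" for s
    unfolding K_def by (rule pv_kernel_near_0[OF C(2) that])
  have far: "set_integrable lborel {1<..} (pv_kernel f x)"
    by (rule truncated_hilbert_integral[OF fm f2]) simp
  have "set_integrable lborel {0<..1} (pv_kernel f x)"
    unfolding set_integrable_def
  proof (rule Bochner_Integration.integrable_bound)
    show "integrable lborel (\<lambda>s. K * (indicator {0<..1} s *\<^sub>R s powr (\<alpha> - 1)))"
      using set_integrable_powr_near_0[OF \<open>\<alpha> > 0\<close>] by (auto simp: set_integrable_def)
    show "AE s in lborel. norm (indicator {0<..1} s *\<^sub>R pv_kernel f x s) \<le> norm (K * (indicator {0<..1} s *\<^sub>R s powr (\<alpha> - 1)))"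
    proof (rule AE_I2)
      fix s
      show "norm (indicator {0<..1} s *\<^sub>R pv_kernel f x s) \<le> norm (K * (indicator {0<..1} s *\<^sub>R s powr (\<alpha> - 1)))"
        using near[of s] by (cases "0 < s \<and> s \<le> 1") auto
    qed
  qed auto
  then have "set_integrable lborel ({0<..1} \<union> {1<..}) (pv_kernel f x)"
    using far by (rule set_integrable_Un) auto
  moreover have "{0<..1} \<union> {1<..} = {0::real<..}" by auto
  ultimately show int: "set_integrable lborel {0<..} (pv_kernel f x)" by simp
  have "((\<lambda>\<delta>. LINT s : {\<delta><..} | lborel. pv_kernel f x s) \<longlongrightarrow> (LINT s : {0<..} | lborel. pv_kernel f x s)) (at_right 0)"
    unfolding filterlim_at_right_to_top set_lebesgue_integral_def
  proof (rule integral_dominated_convergence_at_top)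
    show "integrable lborel (\<lambda>s. \<bar>indicator {0<..} s *\<^sub>R pv_kernel f x s\<bar>)"
      using int by (auto simp: set_integrable_def)
    show "\<forall>\<^sub>F n in at_top. AE s in lborel. norm (indicator {inverse n<..} s *\<^sub>R pv_kernel f x s) \<le> \<bar>indicator {0<..} s *\<^sub>R pv_kernel f x s\<bar>"
      using eventually_gt_at_top[of 0]
      by eventually_elim (intro AE_I2, auto simp: indicator_def dest: positive_imp_inverse_positive)
    show "AE s in lborel. ((\<lambda>n. indicator {inverse n<..} s *\<^sub>R pv_kernel f x s) \<longlongrightarrow> indicator {0<..} s *\<^sub>R pv_kernel f x s) at_top"
    proof (rule AE_I2)
      fix s :: real
      have "\<forall>\<^sub>F n in at_top. indicator {inverse n<..} s = (indicator {0<..} s :: real)"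
      proof (cases "s > 0")
        case True
        show ?thesis using eventually_gt_at_top[of "inverse s"]
        proof eventually_elim
          case (elim n)
          then have "inverse n < s" using True
            by (metis inverse_inverse_eq inverse_less_imp_less inverse_positive_iff_positive less_imp_inverse_less)
          then show ?case using True by simp
        qed
      next
        case False
        show ?thesis using eventually_gt_at_top[of 0]
          by eventually_elim (use False in \<open>auto simp: indicator_def dest: positive_imp_inverse_positive\<close>)
      qed
      then show "((\<lambda>n. indicator {inverse n<..} s *\<^sub>R pv_kernel f x s) \<longlongrightarrow> indicator {0<..} s *\<^sub>R pv_kernel f x s) at_top"
        by (intro tendsto_eventually) (auto elim: eventually_mono)
    qed
  qed auto
  moreover have "\<forall>\<^sub>F \<delta> in at_right 0. (LINT s : {\<delta><..} | lborel. pv_kernel f x s)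
      = (LINT t : {t. \<bar>x - t\<bar> > \<delta>} | lborel. f t / (x - t))"
    using eventually_at_right_less[of 0]
    by eventually_elim (rule truncated_hilbert_integral(2)[OF fm f2, symmetric])
  ultimately have "((\<lambda>\<delta>. LINT t : {t. \<bar>x - t\<bar> > \<delta>} | lborel. f t / (x - t))
      \<longlongrightarrow> (LINT s : {0<..} | lborel. pv_kernel f x s)) (at_right 0)"
    by (rule Lim_transform_eventually)
  then show "hilbert_transform f x = (1 / pi) * (LINT s : {0<..} | lborel. pv_kernel f x s)"
    unfolding hilbert_transform_def by (subst tendsto_Lim) auto
qed

lemma hilbert_transform_lincomb:
  assumes "\<alpha> > 0"
    and f: "holder_decay \<alpha> \<rho> f" "integrable lborel (\<lambda>x. (f x)\<^sup>2)"
    and g: "holder_decay \<alpha> \<rho> g" "integrable lborel (\<lambda>x. (g x)\<^sup>2)"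
    and h: "holder_decay \<alpha> \<rho> (\<lambda>t. a * f t - b * g t)" "integrable lborel (\<lambda>t. (a * f t - b * g t)\<^sup>2)"
  shows "hilbert_transform (\<lambda>t. a * f t - b * g t) x = a * hilbert_transform f x - b * hilbert_transform g x"
proof -
  note F = hilbert_transform_eq_pv[OF f(1) \<open>\<alpha> > 0\<close> f(2), of x]
  note G = hilbert_transform_eq_pv[OF g(1) \<open>\<alpha> > 0\<close> g(2), of x]
  have "(LINT s : {0<..} | lborel. pv_kernel (\<lambda>t. a * f t - b * g t) x s)
      = (LINT s : {0<..} | lborel. a * pv_kernel f x s - b * pv_kernel g x s)"
    by (intro set_lebesgue_integral_cong) (auto simp: pv_kernel_def field_simps)
  also have "\<dots> = a * (LINT s : {0<..} | lborel. pv_kernel f x s) - b * (LINT s : {0<..} | lborel. pv_kernel g x s)"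
    using F(1) G(1) by (subst set_integral_diff(2)) (auto simp: set_integrable_mult_right)
  finally have lin: "(LINT s : {0<..} | lborel. pv_kernel (\<lambda>t. a * f t - b * g t) x s)
      = a * (LINT s : {0<..} | lborel. pv_kernel f x s) - b * (LINT s : {0<..} | lborel. pv_kernel g x s)" .
  show ?thesis
    unfolding F(2) G(2) hilbert_transform_eq_pv(2)[OF h(1) \<open>\<alpha> > 0\<close> h(2), of x] lin
    by (simp add: algebra_simps diff_divide_distrib)
qed

section \<open>The commutator of the Hilbert transform with multiplication by the variable\<close>

text \<open>
  Either \<open>\<bar>x - t\<bar>\<close> is comparable to \<open>1 + \<bar>x\<bar>\<close>, and it supplies the factor \<open>1 / (1 + \<bar>x\<bar>)\<close>; or \<open>t\<close> is
  close to \<open>x\<close>, then one power of the weight at \<open>t\<close> supplies that factor and the remaining power,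
  \<open>\<rho> - 1\<close>, together with \<open>1 / \<bar>x - t\<bar>\<close> is bounded by the weight at \<open>x - t\<close>. Both summands on
  the right are integrable in \<open>t\<close>, which makes the kernel of the Hilbert transform integrable.
\<close>
lemma weight_over_distance_le:
  fixes x t :: real
  assumes "\<rho> > 1" and d: "\<bar>x - t\<bar> \<ge> 1"
  shows "(1 + \<bar>t\<bar>) powr - \<rho> / \<bar>x - t\<bar>
    \<le> 4 / (1 + \<bar>x\<bar>) * ((1 + \<bar>t\<bar>) powr - \<rho> + (1 + \<bar>x - t\<bar>) powr - \<rho>)"
proof (cases "(1 + \<bar>x\<bar>) / 4 \<le> \<bar>x - t\<bar>")
  case True
  have "(1 + \<bar>t\<bar>) powr - \<rho> / \<bar>x - t\<bar> \<le> (1 + \<bar>t\<bar>) powr - \<rho> / ((1 + \<bar>x\<bar>) / 4)"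
    using True by (intro divide_left_mono) (auto intro!: mult_pos_pos)
  also have "\<dots> = 4 / (1 + \<bar>x\<bar>) * (1 + \<bar>t\<bar>) powr - \<rho>" by simp
  also have "\<dots> \<le> 4 / (1 + \<bar>x\<bar>) * ((1 + \<bar>t\<bar>) powr - \<rho> + (1 + \<bar>x - t\<bar>) powr - \<rho>)"
    by (intro mult_left_mono) auto
  finally show ?thesis .
next
  case False
  define d where "d = \<bar>x - t\<bar>"
  have d1: "d \<ge> 1" and dx: "d < (1 + \<bar>x\<bar>) / 4" using d False by (auto simp: d_def)
  have t1: "1 + \<bar>t\<bar> \<ge> 3 / 4 * (1 + \<bar>x\<bar>)" using dx by (simp add: d_def abs_if split: if_splits)
  have t2: "1 + \<bar>t\<bar> \<ge> 1 + d" using t1 dx d1 by linarith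
  have "(1 + \<bar>t\<bar>) powr - \<rho> = (1 / (1 + \<bar>t\<bar>)) * (1 + \<bar>t\<bar>) powr - (\<rho> - 1)"
    by (simp add: powr_diff powr_minus divide_inverse)
  also have "\<dots> \<le> (4 / 3 / (1 + \<bar>x\<bar>)) * (1 + d) powr - (\<rho> - 1)"
  proof (intro mult_mono)
    show "1 / (1 + \<bar>t\<bar>) \<le> 4 / 3 / (1 + \<bar>x\<bar>)" using t1 by (simp add: field_simps)
    show "(1 + \<bar>t\<bar>) powr - (\<rho> - 1) \<le> (1 + d) powr - (\<rho> - 1)"
      using t2 d1 assms(1) by (intro powr_mono2') auto
  qed auto
  finally have "(1 + \<bar>t\<bar>) powr - \<rho> * (1 / d) \<le> (4 / 3 / (1 + \<bar>x\<bar>)) * (1 + d) powr - (\<rho> - 1) * (1 / d)"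
    by (rule mult_right_mono) (use d1 in auto)
  also have "\<dots> \<le> (4 / 3 / (1 + \<bar>x\<bar>)) * (1 + d) powr - (\<rho> - 1) * (2 / (1 + d))"
    using d1 by (intro mult_left_mono) (auto simp: field_simps)
  also have "\<dots> = (8 / 3 / (1 + \<bar>x\<bar>)) * (1 + d) powr - \<rho>"
  proof -
    have "(1 + d) powr - \<rho> = (1 + d) powr - (\<rho> - 1) / (1 + d)"
      using powr_diff[of "1 + d" "- (\<rho> - 1)" 1] d1 by simp
    then show ?thesis by (simp only:) simp
  qed
  also have "\<dots> \<le> 4 / (1 + \<bar>x\<bar>) * ((1 + \<bar>t\<bar>) powr - \<rho> + (1 + d) powr - \<rho>)"
    by (intro mult_mono divide_right_mono) auto
  finally show ?thesis by (simp add: d_def)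
qed

text \<open>
  The coefficient \<open>e\<close> lets the majorants \<open>b s\<close>, \<open>b (x - s)\<close> and \<open>b (x + s)\<close> be treated alike.
\<close>
lemma integrable_shear:
  fixes a b :: "real \<Rightarrow> real"
  assumes a: "integrable lborel a" and b: "integrable lborel b" and c: "c \<noteq> 0"
  shows "integrable (lborel \<Otimes>\<^sub>M lborel) (\<lambda>(x, s). a x * b (e * x + c * s))"
proof -
  have [measurable]: "a \<in> borel_measurable borel" "b \<in> borel_measurable borel"
    using borel_measurable_integrable[OF a] borel_measurable_integrable[OF b] by simp_all
  show ?thesis
  proof (rule lborel_pair.Fubini_integrable)
    show "(\<lambda>(x, s). a x * b (e * x + c * s)) \<in> borel_measurable (lborel \<Otimes>\<^sub>M lborel)"
      by measurable
    have "(LINT s|lborel. \<bar>b (e * x + c * s)\<bar>) = (LINT s|lborel. \<bar>b s\<bar>) / \<bar>c\<bar>" for x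
      using lborel_integral_real_affine[OF c, of "\<lambda>s. \<bar>b s\<bar>" "e * x"] c by simp
    then have "(LINT s|lborel. norm (case (x, s) of (x, s) \<Rightarrow> a x * b (e * x + c * s)))
        = \<bar>a x\<bar> * ((LINT s|lborel. \<bar>b s\<bar>) / \<bar>c\<bar>)" for x
      by (simp add: abs_mult)
    then show "integrable lborel (\<lambda>x. LINT s|lborel. norm (case (x, s) of (x, s) \<Rightarrow> a x * b (e * x + c * s)))"
      using a by simp
    show "AE x in lborel. integrable lborel (\<lambda>s. case (x, s) of (x, s) \<Rightarrow> a x * b (e * x + c * s))"
      using lborel_integrable_real_affine[OF b c] by simp
  qed
qed

text \<open>
  The factor \<open>x f x\<close> decays only like \<open>\<bar>x\<bar> powr (1 - \<rho>)\<close>; the missing power comes from the folded kernel,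
  which is \<open>O (1 / (1 + \<bar>x\<bar>))\<close> up to factors integrable in \<open>s\<close>. The majorant is a sum of products to
  which \<open>integrable_shear\<close> applies.
\<close>
lemma weighted_pv_kernel_integrable:
  assumes f: "holder_decay \<alpha> \<rho> f" and g: "holder_decay \<alpha> \<rho> g" and "\<alpha> > 0" "\<rho> > 1"
  shows "integrable (lborel \<Otimes>\<^sub>M lborel) (\<lambda>(x, s). x * f x * (indicator {0<..} s * pv_kernel g x s))"
proof -
  have [measurable]: "f \<in> borel_measurable borel" "g \<in> borel_measurable borel"
    using holder_decay_measurable[OF f \<open>\<alpha> > 0\<close>] holder_decay_measurable[OF g \<open>\<alpha> > 0\<close>] .
  define k where "k x = (1 + \<bar>x\<bar>) powr - \<rho>" for x :: real
  define m where "m s = indicator {0<..1} s * s powr (\<alpha> - 1)" for s :: real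
  obtain C where C: "C > 0" "\<And>x. \<bar>f x\<bar> \<le> C * k x"
    using holder_decayE[OF f] unfolding k_def by metis
  obtain D where D: "D > 0" "\<And>x. \<bar>g x\<bar> \<le> D * k x"
    "\<And>x t. \<bar>x - t\<bar> \<le> 1 \<Longrightarrow> \<bar>g x - g t\<bar> \<le> D * (1 + \<bar>x\<bar>) powr - \<rho> * \<bar>x - t\<bar> powr \<alpha>"
    using holder_decayE[OF g] unfolding k_def by metis
  have k0: "k x > 0" for x by (simp add: k_def add_pos_nonneg)
  have kk: "integrable lborel k" unfolding k_def by (rule integrable_powr_weight[OF \<open>\<rho> > 1\<close>])
  have mm: "integrable lborel m"
    using set_integrable_powr_near_0[OF \<open>\<alpha> > 0\<close>] by (simp add: set_integrable_def m_def[abs_def])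
  have m0: "m s \<ge> 0" for s by (simp add: m_def)
  have k1: "(1 + \<bar>x\<bar>) * k x \<le> 1" for x
    unfolding k_def using \<open>\<rho> > 1\<close> by (intro one_plus_abs_mult_weight_le_1) simp
  have xf: "\<bar>x * f x\<bar> \<le> C * ((1 + \<bar>x\<bar>) * k x)" for x
  proof -
    have "\<bar>x\<bar> * \<bar>f x\<bar> \<le> (1 + \<bar>x\<bar>) * (C * k x)" using C(2)[of x] by (intro mult_mono) auto
    then show ?thesis by (simp add: abs_mult algebra_simps)
  qed
  have pv: "\<bar>pv_kernel g x s\<bar> \<le> 2 * D * k x * m s + 8 * D / (1 + \<bar>x\<bar>) * (k (x - s) + k (x + s) + k s)"
    (is "_ \<le> ?N + ?F") if "s > 0" for x s
  proof (cases "s \<le> 1")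
    case True
    have "\<bar>pv_kernel g x s\<bar> \<le> ?N"
      using pv_kernel_near_0[OF D(3) that True] that True by (simp add: k_def m_def)
    moreover have "?F \<ge> 0" using D(1) k0 by (simp add: less_imp_le)
    ultimately show ?thesis by linarith
  next
    case False
    have far: "\<bar>g t / s\<bar> \<le> 4 * D / (1 + \<bar>x\<bar>) * (k t + k s)" if "\<bar>x - t\<bar> = s" for t
    proof -
      have "\<bar>g t / s\<bar> \<le> D * k t / s" using D(2)[of t] False by (simp add: divide_right_mono)
      also have "\<dots> = D * (k t / s)" by simp
      also have "\<dots> \<le> D * (4 / (1 + \<bar>x\<bar>) * (k t + k s))"
        using weight_over_distance_le[OF \<open>\<rho> > 1\<close>, of x t] D(1) that False
        by (intro mult_left_mono) (auto simp: k_def)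
      also have "\<dots> = 4 * D / (1 + \<bar>x\<bar>) * (k t + k s)" by (simp add: algebra_simps)
      finally show ?thesis .
    qed
    have "\<bar>pv_kernel g x s\<bar> \<le> \<bar>g (x - s) / s\<bar> + \<bar>g (x + s) / s\<bar>"
      unfolding pv_kernel_def diff_divide_distrib by linarith
    also have "\<dots> \<le> 4 * D / (1 + \<bar>x\<bar>) * (k (x - s) + k s) + 4 * D / (1 + \<bar>x\<bar>) * (k (x + s) + k s)"
      using that by (intro add_mono far) auto
    also have "\<dots> = 4 * D / (1 + \<bar>x\<bar>) * (k (x - s) + k (x + s) + 2 * k s)"
      by (simp add: algebra_simps add_divide_distrib)
    also have "\<dots> \<le> 4 * D / (1 + \<bar>x\<bar>) * (2 * (k (x - s) + k (x + s) + k s))"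
      using D(1) k0[of "x - s"] k0[of "x + s"] by (intro mult_left_mono) auto
    also have "\<dots> = ?F" by (simp add: algebra_simps add_divide_distrib)
    finally have "\<bar>pv_kernel g x s\<bar> \<le> ?F" .
    moreover have "?N \<ge> 0" using D(1) k0[of x] m0[of s] by simp
    ultimately show ?thesis by linarith
  qed
  define M where "M x s = 8 * C * D * (k x * m (0 * x + 1 * s) + k x * k (1 * x + (-1) * s)
      + k x * k (1 * x + 1 * s) + k x * k (0 * x + 1 * s))" for x s
  have bound: "\<bar>x * f x * (indicator {0<..} s * pv_kernel g x s)\<bar> \<le> M x s" for x s
  proof (cases "s > 0")
    case True
    have "\<bar>x * f x * pv_kernel g x s\<bar> \<le> (C * ((1 + \<bar>x\<bar>) * k x))
        * (2 * D * k x * m s + 8 * D / (1 + \<bar>x\<bar>) * (k (x - s) + k (x + s) + k s))"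
      unfolding abs_mult[of "x * f x"]
      using xf[of x] pv[OF True, of x] C(1) k0[of x] by (intro mult_mono) auto
    also have "\<dots> = 2 * C * D * (((1 + \<bar>x\<bar>) * k x) * (k x * m s))
        + 8 * C * D * (k x * (k (x - s) + k (x + s) + k s))"
    proof -
      have "(C * (X * a)) * (2 * D * a * b + 8 * D / X * T) = 2 * C * D * ((X * a) * (a * b)) + 8 * C * D * (a * T)"
        if "X > 0" for X a b T
        using that by (simp add: field_simps)
      then show ?thesis by (simp add: add_pos_nonneg)
    qed
    also have "\<dots> \<le> 2 * C * D * (1 * (k x * m s)) + 8 * C * D * (k x * (k (x - s) + k (x + s) + k s))"
      using k1[of x] C(1) D(1) k0[of x] m0[of s]
      by (intro add_right_mono mult_left_mono mult_right_mono) auto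
    also have "\<dots> \<le> 8 * C * D * (k x * m s) + 8 * C * D * (k x * (k (x - s) + k (x + s) + k s))"
      using C(1) D(1) k0[of x] m0[of s] by simp
    also have "\<dots> = M x s" by (simp add: M_def algebra_simps)
    finally show ?thesis using True by simp
  next
    case False
    then show ?thesis using C(1) D(1) k0 m0 by (simp add: M_def less_imp_le add_nonneg_nonneg)
  qed
  show ?thesis
  proof (rule Bochner_Integration.integrable_bound)
    have "integrable (lborel \<Otimes>\<^sub>M lborel)
        (\<lambda>p. 8 * C * D * ((case p of (x, s) \<Rightarrow> k x * m (0 * x + 1 * s))
          + (case p of (x, s) \<Rightarrow> k x * k (1 * x + (-1) * s))
          + (case p of (x, s) \<Rightarrow> k x * k (1 * x + 1 * s)) + (case p of (x, s) \<Rightarrow> k x * k (0 * x + 1 * s))))"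
      by (intro integrable_mult_right Bochner_Integration.integrable_add integrable_shear kk mm) auto
    then show "integrable (lborel \<Otimes>\<^sub>M lborel) (\<lambda>(x, s). M x s)"
      by (simp only: M_def split_def)
    show "(\<lambda>(x, s). x * f x * (indicator {0<..} s * pv_kernel g x s)) \<in> borel_measurable (lborel \<Otimes>\<^sub>M lborel)"
      unfolding pv_kernel_def by measurable
    have "norm (x * f x * (indicator {0<..} s * pv_kernel g x s)) \<le> norm (M x s)" for x s
      using bound[of x s] by simp
    then show "AE p in lborel \<Otimes>\<^sub>M lborel. norm (case p of (x, s) \<Rightarrow> x * f x * (indicator {0<..} s * pv_kernel g x s))
        \<le> norm (case p of (x, s) \<Rightarrow> M x s)"
      by (intro AE_I2) (simp only: split_beta)
  qed
qed

lemma integral_pos_reflections: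
  fixes g :: "real \<Rightarrow> real"
  assumes g: "integrable lborel g"
  shows "(LINT s|lborel. indicator {0<..} s * (g (x - s) + g (x + s))) = (LINT t|lborel. g t)"
proof -
  have [measurable]: "g \<in> borel_measurable borel" using borel_measurable_integrable[OF g] by simp
  have p: "integrable lborel (\<lambda>s. g (x + s))"
    using lborel_integrable_real_affine[OF g, of 1 x] by simp
  have m: "integrable lborel (\<lambda>s. g (x - s))"
    using lborel_integrable_real_affine[OF g, of "-1" x] by simp
  have ip: "integrable lborel (\<lambda>s. indicator A s * g (x + s))" if "A \<in> sets borel" for A
    using integrable_mult_indicator[OF _ p, of A] that by simp
  have im: "integrable lborel (\<lambda>s. indicator A s * g (x - s))" if "A \<in> sets borel" for A
    using integrable_mult_indicator[OF _ m, of A] that by simp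
  have "(LINT s|lborel. indicator {0<..} s * (g (x - s) + g (x + s)))
      = (LINT s|lborel. indicator {0<..} s * g (x - s)) + (LINT s|lborel. indicator {0<..} s * g (x + s))"
    unfolding distrib_left by (intro Bochner_Integration.integral_add im ip) auto
  also have "(LINT s|lborel. indicator {0<..} s * g (x - s)) = (LINT s|lborel. indicator {..<0} s * g (x + s))"
    by (subst lborel_integral_real_affine[where c = "-1" and t = 0])
       (auto simp: indicator_def intro!: Bochner_Integration.integral_cong)
  also have "(LINT s|lborel. indicator {..<0} s * g (x + s)) + (LINT s|lborel. indicator {0<..} s * g (x + s))
      = (LINT s|lborel. indicator {..<0} s * g (x + s) + indicator {0<..} s * g (x + s))"
    by (intro Bochner_Integration.integral_add[symmetric] ip) auto
  also have "\<dots> = (LINT s|lborel. g (x + s))"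
  proof (rule integral_cong_AE)
    show "AE s in lborel. indicator {..<0} s * g (x + s) + indicator {0<..} s * g (x + s) = g (x + s)"
      using AE_lborel_singleton[of "0::real"] by eventually_elim (auto simp: indicator_def)
  qed auto
  also have "\<dots> = (LINT t|lborel. g t)"
    using lborel_integral_real_affine[of 1 g x] by simp
  finally show ?thesis .
qed

text \<open>
  With \<open>\<pi> H g x = \<integral>\<^sub>0\<^sup>\<infinity> (g (x - s) - g (x + s)) / s ds\<close> and Fubini, the left-hand side is an integral
  over \<open>s > 0\<close> of integrals over \<open>x\<close>. For fixed \<open>s\<close>, translating \<open>x\<close> by \<open>\<plusminus> s\<close> in the terms with \<open>g x\<close>
  moves \<open>f\<close> to the point \<open>x\<close> and changes the factor \<open>x\<close> by \<open>s\<close>; the parts with factor \<open>x\<close> cancel and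
  the factor \<open>s\<close> cancels the denominator. What is left is \<open>\<integral> f x (g (x - s) + g (x + s)) dx\<close>, whose
  integral over \<open>s > 0\<close> is \<open>\<integral> f \<integral> g\<close>.
\<close>
lemma hilbert_weighted_identity:
  assumes f: "holder_decay \<alpha> \<rho> f" and g: "holder_decay \<alpha> \<rho> g" and "\<alpha> > 0" "\<rho> > 1"
  shows "integrable lborel (\<lambda>x. x * f x * hilbert_transform g x)"
    and "(LINT x|lborel. x * f x * hilbert_transform g x) + (LINT x|lborel. x * g x * hilbert_transform f x)
      = (1 / pi) * ((LINT x|lborel. f x) * (LINT x|lborel. g x))"
proof -
  let ?P = "\<lambda>f g x s. x * f x * (indicator {0<..} s * pv_kernel g x s)"
  have joint: "integrable (lborel \<Otimes>\<^sub>M lborel) (case_prod (?P f g))" 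
    if "holder_decay \<alpha> \<rho> f" "holder_decay \<alpha> \<rho> g" for f g
    by (rule weighted_pv_kernel_integrable[OF that \<open>\<alpha> > 0\<close> \<open>\<rho> > 1\<close>])
  have inner: "(LINT s|lborel. ?P f g x s) = pi * (x * f x * hilbert_transform g x)"
    if "holder_decay \<alpha> \<rho> g" for f g x
    using hilbert_transform_eq_pv(2)[OF that \<open>\<alpha> > 0\<close> holder_decay_integrable(2)[OF that \<open>\<alpha> > 0\<close> \<open>\<rho> > 1\<close>], of x]
    by (simp add: set_lebesgue_integral_def)
  have int_H: "integrable lborel (\<lambda>x. x * f x * hilbert_transform g x)"
    and H_swap: "pi * (LINT x|lborel. x * f x * hilbert_transform g x) = (LINT s|lborel. LINT x|lborel. ?P f g x s)"
    and int_swap: "integrable lborel (\<lambda>s. LINT x|lborel. ?P f g x s)"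
    if "holder_decay \<alpha> \<rho> f" "holder_decay \<alpha> \<rho> g" for f g
  proof -
    have "integrable lborel (\<lambda>x. pi * (x * f x * hilbert_transform g x))"
      using lborel_pair.integrable_fst[OF joint[OF that]] unfolding inner[OF that(2)] .
    then show "integrable lborel (\<lambda>x. x * f x * hilbert_transform g x)" by simp
    show "pi * (LINT x|lborel. x * f x * hilbert_transform g x) = (LINT s|lborel. LINT x|lborel. ?P f g x s)"
      using lborel_pair.Fubini_integral[OF joint[OF that]] unfolding inner[OF that(2)] by simp
    show "integrable lborel (\<lambda>s. LINT x|lborel. ?P f g x s)"
      by (rule lborel_pair.integrable_snd[OF joint[OF that]])
  qed
  show "integrable lborel (\<lambda>x. x * f x * hilbert_transform g x)" by (rule int_H[OF f g])
  note fi = holder_decay_integrable(1)[OF f \<open>\<alpha> > 0\<close> \<open>\<rho> > 1\<close>]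
  note gi = holder_decay_integrable(1)[OF g \<open>\<alpha> > 0\<close> \<open>\<rho> > 1\<close>]
  have [measurable]: "f \<in> borel_measurable borel" "g \<in> borel_measurable borel"
    using holder_decay_measurable[OF f \<open>\<alpha> > 0\<close>] holder_decay_measurable[OF g \<open>\<alpha> > 0\<close>] .
  have shifted: "integrable lborel (\<lambda>x. x * f x * g (x + s))"
    if f: "holder_decay \<alpha> \<rho> f" and g: "holder_decay \<alpha> \<rho> g" for f g s
  proof -
    note [measurable] = holder_decay_measurable[OF f \<open>\<alpha> > 0\<close>] holder_decay_measurable[OF g \<open>\<alpha> > 0\<close>]
    obtain C where C: "C > 0" "\<And>x. \<bar>f x\<bar> \<le> C * (1 + \<bar>x\<bar>) powr - \<rho>"
      using holder_decayE[OF f] by metis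
    have xf: "\<bar>x * f x\<bar> \<le> C" for x
    proof -
      have "\<bar>x\<bar> * \<bar>f x\<bar> \<le> (1 + \<bar>x\<bar>) * (C * (1 + \<bar>x\<bar>) powr - \<rho>)"
        using C(2)[of x] by (intro mult_mono) auto
      also have "\<dots> = C * ((1 + \<bar>x\<bar>) * (1 + \<bar>x\<bar>) powr - \<rho>)" by simp
      also have "\<dots> \<le> C * 1"
        using \<open>\<rho> > 1\<close> C(1) by (intro mult_left_mono one_plus_abs_mult_weight_le_1) auto
      finally show ?thesis by (simp add: abs_mult)
    qed
    have "integrable lborel (\<lambda>x. C * g (s + 1 * x))"
      using lborel_integrable_real_affine[OF holder_decay_integrable(1)[OF g \<open>\<alpha> > 0\<close> \<open>\<rho> > 1\<close>], of 1 s] by simp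
    then show ?thesis
    proof (rule Bochner_Integration.integrable_bound)
      show "AE x in lborel. norm (x * f x * g (x + s)) \<le> norm (C * g (s + 1 * x))"
        using xf C(1) by (intro AE_I2) (auto simp: abs_mult add.commute intro!: mult_right_mono)
    qed measurable
  qed
  have slice: "(LINT x|lborel. ?P f g x s) + (LINT x|lborel. ?P g f x s)
      = (LINT x|lborel. f x * (indicator {0<..} s * (g (x - s) + g (x + s))))" for s
  proof (cases "s > 0")
    case True
    have P: "(LINT x|lborel. ?P f g x s)
        = ((LINT x|lborel. x * f x * g (x + - s)) - (LINT x|lborel. x * f x * g (x + s))) / s"
      if "holder_decay \<alpha> \<rho> f" "holder_decay \<alpha> \<rho> g" for f g
    proof -
      have "(LINT x|lborel. ?P f g x s) = (LINT x|lborel. (x * f x * g (x + - s) - x * f x * g (x + s)) / s)"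
        using True by (simp add: pv_kernel_def right_diff_distrib)
      also have "\<dots> = (LINT x|lborel. x * f x * g (x + - s) - x * f x * g (x + s)) / s"
        by (rule integral_divide_zero)
      also have "\<dots> = ((LINT x|lborel. x * f x * g (x + - s)) - (LINT x|lborel. x * f x * g (x + s))) / s"
        by (subst Bochner_Integration.integral_diff[OF shifted[OF that] shifted[OF that]]) (rule refl)
      finally show ?thesis .
    qed
    have move: "(LINT x|lborel. x * g x * f (x + r)) = (LINT x|lborel. (x - r) * (f x * g (x - r)))" for r
      by (subst lborel_integral_real_affine[where c = 1 and t = "- r"]) (auto simp: algebra_simps)
    have move_int: "integrable lborel (\<lambda>x. (x - r) * (f x * g (x - r)))" for r
      using lborel_integrable_real_affine[OF shifted[OF g f, of r], of 1 "- r"] by (simp add: algebra_simps)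
    have diff: "(LINT x|lborel. x * f x * g (x - r)) - (LINT x|lborel. x * g x * f (x + r))
        = r * (LINT x|lborel. f x * g (x - r))" for r
    proof -
      have "(LINT x|lborel. x * f x * g (x - r)) - (LINT x|lborel. x * g x * f (x + r))
          = (LINT x|lborel. x * f x * g (x - r) - (x - r) * (f x * g (x - r)))"
        unfolding move using shifted[OF f g, of "- r"] move_int[of r]
        by (subst Bochner_Integration.integral_diff) simp_all
      also have "\<dots> = (LINT x|lborel. r * (f x * g (x - r)))"
        by (simp add: algebra_simps)
      finally show ?thesis by simp
    qed
    \<comment> \<open>A byproduct of the translation: \<open>r f x g (x - r)\<close> is a difference of integrable functions.\<close>
    have fg: "integrable lborel (\<lambda>x. f x * g (x - r))" if "r \<noteq> 0" for r
    proof -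
      have "integrable lborel (\<lambda>x. (x * f x * g (x - r) - (x - r) * (f x * g (x - r))) / r)"
        using shifted[OF f g, of "- r"] move_int[of r] by simp
      moreover have "(x * f x * g (x - r) - (x - r) * (f x * g (x - r))) / r = f x * g (x - r)" for x
        using that by (simp add: field_simps)
      ultimately show ?thesis by simp
    qed
    have "(LINT x|lborel. ?P f g x s) + (LINT x|lborel. ?P g f x s)
        = (((LINT x|lborel. x * f x * g (x - s)) - (LINT x|lborel. x * g x * f (x + s)))
          - ((LINT x|lborel. x * f x * g (x - (- s))) - (LINT x|lborel. x * g x * f (x + - s)))) / s"
      unfolding P[OF f g] P[OF g f] by (simp add: diff_divide_distrib)
    also have "\<dots> = (LINT x|lborel. f x * g (x - s)) + (LINT x|lborel. f x * g (x + s))"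
      unfolding diff using True by (simp add: field_simps)
    also have "\<dots> = (LINT x|lborel. f x * (indicator {0<..} s * (g (x - s) + g (x + s))))"
      using True fg[of s] fg[of "- s"] by (simp add: distrib_left)
    finally show ?thesis .
  qed simp
  have "pi * ((LINT x|lborel. x * f x * hilbert_transform g x) + (LINT x|lborel. x * g x * hilbert_transform f x))
      = (LINT s|lborel. (LINT x|lborel. ?P f g x s) + (LINT x|lborel. ?P g f x s))"
    unfolding distrib_left H_swap[OF f g] H_swap[OF g f]
    by (rule Bochner_Integration.integral_add[symmetric]) (rule int_swap[OF f g], rule int_swap[OF g f])
  also have "\<dots> = (LINT s|lborel. LINT x|lborel. f x * (indicator {0<..} s * (g (x - s) + g (x + s))))"
    unfolding slice ..
  also have "\<dots> = (LINT x|lborel. LINT s|lborel. f x * (indicator {0<..} s * (g (x - s) + g (x + s))))"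
  proof (rule lborel_pair.Fubini_integral, rule Bochner_Integration.integrable_bound)
    have "integrable (lborel \<Otimes>\<^sub>M lborel)
        (\<lambda>p. \<bar>case p of (x, s) \<Rightarrow> f x * g (1 * x + (-1) * s)\<bar> + \<bar>case p of (x, s) \<Rightarrow> f x * g (1 * x + 1 * s)\<bar>)"
      by (intro Bochner_Integration.integrable_add integrable_abs integrable_shear fi gi) auto
    then show "integrable (lborel \<Otimes>\<^sub>M lborel) (\<lambda>(x, s). \<bar>f x * g (x - s)\<bar> + \<bar>f x * g (x + s)\<bar>)"
      by (simp add: split_def)
    have "\<bar>f x * (indicator {0<..} s * (g (x - s) + g (x + s)))\<bar> \<le> \<bar>\<bar>f x * g (x - s)\<bar> + \<bar>f x * g (x + s)\<bar>\<bar>" for x s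
      using abs_triangle_ineq[of "f x * g (x - s)" "f x * g (x + s)"] by (simp add: indicator_def distrib_left)
    then show "AE p in lborel \<Otimes>\<^sub>M lborel. norm (case p of (x, s) \<Rightarrow> f x * (indicator {0<..} s * (g (x - s) + g (x + s))))
        \<le> norm (case p of (x, s) \<Rightarrow> \<bar>f x * g (x - s)\<bar> + \<bar>f x * g (x + s)\<bar>)"
      by (intro AE_I2) auto
  qed measurable
  also have "\<dots> = (LINT x|lborel. f x * (LINT t|lborel. g t))"
    using integral_pos_reflections[OF gi] by simp
  also have "\<dots> = (LINT x|lborel. f x) * (LINT x|lborel. g x)" by simp
  finally show "(LINT x|lborel. x * f x * hilbert_transform g x) + (LINT x|lborel. x * g x * hilbert_transform f x)
      = (1 / pi) * ((LINT x|lborel. f x) * (LINT x|lborel. g x))"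
    by (simp add: field_simps)
qed

section \<open>A maximum principle for the Hilbert transform of a derivative\<close>

text \<open>
  Let \<open>U s = 2 u x - u (x + s) - u (x - s)\<close>, which is nonnegative at a maximum. The derivative of \<open>U\<close>
  is \<open>s\<close> times the kernel, so integration by parts turns the integral of the kernel into
  \<open>\<integral> U s / s\<^sup>2 ds \<ge> 0\<close>; the boundary terms \<open>U s / s\<close> vanish at \<open>0\<close> because \<open>U\<close> has derivative \<open>0\<close>
  there, and at infinity because \<open>u\<close> is bounded. A lower bound \<open>c\<close> for \<open>U\<close> beyond \<open>S\<close> contributes
  \<open>\<integral>\<^sub>S\<^sup>\<infinity> c / s\<^sup>2 ds = c / S\<close>, which makes the strict version below possible.
\<close>
lemma hilbert_transform_at_max:
  assumes f: "holder_decay \<alpha> \<rho> f" and "\<alpha> > 0" and f2: "integrable lborel (\<lambda>x. (f x)\<^sup>2)"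
    and d: "\<And>t. (u has_real_derivative f t) (at t)"
    and bdd: "\<And>t. \<bar>u t\<bar> \<le> B"
    and max: "\<And>t. u t \<le> u x"
    and c: "c \<ge> 0" "S \<ge> 1" "\<And>s. s \<ge> S \<Longrightarrow> c \<le> 2 * u x - u (x + s) - u (x - s)"
  shows "c / S \<le> pi * hilbert_transform f x"
proof -
  note pv = hilbert_transform_eq_pv[OF f \<open>\<alpha> > 0\<close> f2, of x]
  define U where "U s = 2 * u x - u (x + s) - u (x - s)" for s
  have U0: "U s \<ge> 0" for s using max[of "x + s"] max[of "x - s"] by (simp add: U_def)
  have fc: "continuous_on A f" for A
    using holder_decay_continuous[OF f \<open>\<alpha> > 0\<close>] continuous_on_subset by blast
  have dU: "(U has_real_derivative s * pv_kernel f x s) (at s)" for s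
  proof -
    have "((\<lambda>s. u (x + s)) has_real_derivative f (x + s)) (at s)"
      using DERIV_shift[of u "f (x + s)" s x] d by (simp add: add.commute)
    moreover have "((\<lambda>s. u (x - s)) has_real_derivative f (x - s) * (- 1)) (at s)"
      by (rule DERIV_chain2[where f = u and g = "\<lambda>s. x - s", OF d]) (auto intro!: derivative_eq_intros)
    ultimately have "(U has_real_derivative 0 - f (x + s) - f (x - s) * (- 1)) (at s)"
      unfolding U_def by (intro DERIV_diff DERIV_const)
    then show ?thesis by (cases "s = 0") (simp_all add: pv_kernel_def)
  qed
  have uc: "continuous_on A u" for A
    using d by (meson DERIV_isCont continuous_at_imp_continuous_on)
  have Uc: "continuous_on A U" for A
    unfolding U_def by (intro continuous_intros continuous_on_compose2[OF uc[of UNIV]]) auto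
  have main: "U R / R - U \<delta> / \<delta> + c * (1 / S - 1 / R) \<le> (LINT s : {\<delta>..R} | lborel. pv_kernel f x s)"
    if "0 < \<delta>" "\<delta> \<le> 1" "S \<le> R" for \<delta> R
  proof -
    have pc: "continuous_on {\<delta>..R} (pv_kernel f x)"
      unfolding pv_kernel_def using that
      by (intro continuous_intros continuous_on_compose2[OF fc[of UNIV]]) auto
    have ftc: "((\<lambda>s. pv_kernel f x s - U s / s\<^sup>2) has_integral (U R / R - U \<delta> / \<delta>)) {\<delta>..R}"
    proof (rule fundamental_theorem_of_calculus)
      show "\<delta> \<le> R" using that c(2) by linarith
      fix s assume s: "s \<in> {\<delta>..R}"
      then have "s > 0" using that by auto
      have "((\<lambda>s. U s / s) has_real_derivative pv_kernel f x s - U s / s\<^sup>2) (at s)"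
        using \<open>s > 0\<close> by (auto intro!: derivative_eq_intros dU simp: field_simps power2_eq_square)
      then show "((\<lambda>s. U s / s) has_vector_derivative pv_kernel f x s - U s / s\<^sup>2) (at s within {\<delta>..R})"
        using has_field_derivative_at_within has_real_derivative_iff_has_vector_derivative by blast
    qed
    have "(pv_kernel f x has_integral (LINT s : {\<delta>..R} | lborel. pv_kernel f x s)) {\<delta>..R}"
      using set_borel_integral_eq_integral[OF borel_integrable_atLeastAtMost'[OF pc]]
      by (simp add: has_integral_iff)
    from has_integral_diff[OF this ftc]
    have iU: "((\<lambda>s. U s / s\<^sup>2) has_integral
        ((LINT s : {\<delta>..R} | lborel. pv_kernel f x s) - (U R / R - U \<delta> / \<delta>))) {\<delta>..R}" by simp
    have ic: "((\<lambda>s. c / s\<^sup>2) has_integral (- c / R - (- c / S))) {S..R}"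
    proof (rule fundamental_theorem_of_calculus)
      fix s assume "s \<in> {S..R}"
      then have "s > 0" using c by auto
      then have "((\<lambda>s. - c / s) has_real_derivative c / s\<^sup>2) (at s)"
        by (auto intro!: derivative_eq_intros simp: field_simps power2_eq_square)
      then show "((\<lambda>s. - c / s) has_vector_derivative c / s\<^sup>2) (at s within {S..R})"
        using has_field_derivative_at_within has_real_derivative_iff_has_vector_derivative by blast
    qed fact
    have i2: "(\<lambda>s. U s / s\<^sup>2) integrable_on {S..R}"
      by (rule integrable_subinterval_real[OF has_integral_integrable[OF iU]]) (use that c(2) in auto)
    have "- c / R - (- c / S) \<le> integral {S..R} (\<lambda>s. U s / s\<^sup>2)"
      using c(3) by (intro has_integral_le[OF ic integrable_integral[OF i2]] divide_right_mono) (auto simp: U_def)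
    also have "\<dots> \<le> integral {\<delta>..R} (\<lambda>s. U s / s\<^sup>2)"
      by (rule integral_subset_le[OF _ i2 has_integral_integrable[OF iU]]) (use that c(2) U0 in auto)
    also have "\<dots> = (LINT s : {\<delta>..R} | lborel. pv_kernel f x s) - (U R / R - U \<delta> / \<delta>)"
      using iU by (rule integral_unique)
    finally have "- c / R - (- c / S) \<le> (LINT s : {\<delta>..R} | lborel. pv_kernel f x s) - (U R / R - U \<delta> / \<delta>)" .
    then show ?thesis by (simp add: algebra_simps)
  qed
  define \<delta> where "\<delta> n = 1 / real (Suc n)" for n
  define R where "R n = real (Suc n) + S" for n
  have [measurable]: "f \<in> borel_measurable borel"
    using holder_decay_measurable[OF f \<open>\<alpha> > 0\<close>] .
  have [measurable]: "pv_kernel f x \<in> borel_measurable borel"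
    unfolding pv_kernel_def by measurable
  have \<delta>0: "\<delta> \<longlonglongrightarrow> 0"
    unfolding \<delta>_def using LIMSEQ_inverse_real_of_nat by (simp add: inverse_eq_divide)
  have Rinf: "filterlim R at_top sequentially"
    by (rule filterlim_at_top_mono[OF filterlim_real_sequentially]) (use c(2) in \<open>auto simp: R_def\<close>)
  have lim: "(\<lambda>n. LINT s : {\<delta> n..R n} | lborel. pv_kernel f x s) \<longlonglongrightarrow> (LINT s : {0<..} | lborel. pv_kernel f x s)"
    unfolding set_lebesgue_integral_def
  proof (rule integral_dominated_convergence)
    show "integrable lborel (\<lambda>s. \<bar>indicator {0<..} s *\<^sub>R pv_kernel f x s\<bar>)"
      using pv(1) by (auto simp: set_integrable_def)
    show "AE s in lborel. norm (indicator {\<delta> n..R n} s *\<^sub>R pv_kernel f x s) \<le> \<bar>indicator {0<..} s *\<^sub>R pv_kernel f x s\<bar>" for n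
      by (intro AE_I2) (auto simp: indicator_def \<delta>_def intro: less_le_trans[rotated])
    show "AE s in lborel. (\<lambda>n. indicator {\<delta> n..R n} s *\<^sub>R pv_kernel f x s) \<longlonglongrightarrow> indicator {0<..} s *\<^sub>R pv_kernel f x s"
    proof (rule AE_I2)
      fix s :: real
      have "\<forall>\<^sub>F n in sequentially. indicator {\<delta> n..R n} s = (indicator {0<..} s :: real)"
      proof (cases "s > 0")
        case True
        have "\<forall>\<^sub>F n in sequentially. \<delta> n < s" using order_tendstoD(2)[OF \<delta>0 True] .
        moreover have "\<forall>\<^sub>F n in sequentially. s \<le> R n" using Rinf by (simp add: filterlim_at_top)
        ultimately show ?thesis by eventually_elim (use True in auto)
      next
        case False
        then have "\<not> \<delta> n \<le> s" for n
          unfolding \<delta>_def by (smt (verit) divide_pos_pos of_nat_0_less_iff zero_less_Suc)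
        then show ?thesis using False by simp
      qed
      then show "(\<lambda>n. indicator {\<delta> n..R n} s *\<^sub>R pv_kernel f x s) \<longlonglongrightarrow> indicator {0<..} s *\<^sub>R pv_kernel f x s"
        by (intro tendsto_eventually) (auto elim: eventually_mono)
    qed
  qed auto
  have "(\<lambda>n. U (R n) / R n) \<longlonglongrightarrow> 0"
  proof (rule Lim_null_comparison)
    show "\<forall>\<^sub>F n in sequentially. norm (U (R n) / R n) \<le> 4 * B / R n"
    proof (rule always_eventually, rule allI)
      fix n
      have "R n > 0" using c by (simp add: R_def)
      moreover have "\<bar>U (R n)\<bar> \<le> 4 * B"
        using bdd[of x] bdd[of "x + R n"] bdd[of "x - R n"] by (simp add: U_def)
      ultimately show "norm (U (R n) / R n) \<le> 4 * B / R n" by (simp add: divide_right_mono)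
    qed
    show "(\<lambda>n. 4 * B / R n) \<longlonglongrightarrow> 0"
      using Rinf by (rule real_tendsto_divide_at_top[OF tendsto_const])
  qed
  moreover have "(\<lambda>n. U (\<delta> n) / \<delta> n) \<longlonglongrightarrow> 0"
  proof -
    have "(U has_real_derivative 0 * pv_kernel f x 0) (at 0)" by (rule dU)
    then have "((\<lambda>h. U h / h) \<longlongrightarrow> 0) (at 0)"
      by (auto dest!: DERIV_D simp: U_def)
    moreover have "filterlim \<delta> (at 0) sequentially"
      using \<delta>0 by (intro filterlim_atI) (auto simp: \<delta>_def)
    ultimately show ?thesis by (rule filterlim_compose)
  qed
  moreover have "(\<lambda>n. 1 / R n) \<longlonglongrightarrow> 0"
    using Rinf by (rule real_tendsto_divide_at_top[OF tendsto_const])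
  ultimately have "(\<lambda>n. U (R n) / R n - U (\<delta> n) / \<delta> n + c * (1 / S - 1 / R n)) \<longlonglongrightarrow> 0 - 0 + c * (1 / S - 0)"
    by (intro tendsto_intros)
  then have "0 - 0 + c * (1 / S - 0) \<le> (LINT s : {0<..} | lborel. pv_kernel f x s)"
  proof (rule LIMSEQ_le[OF _ lim])
    show "\<exists>N. \<forall>n\<ge>N. U (R n) / R n - U (\<delta> n) / \<delta> n + c * (1 / S - 1 / R n) \<le> (LINT s : {\<delta> n..R n} | lborel. pv_kernel f x s)"
      by (intro exI[of _ 0] allI impI main) (auto simp: \<delta>_def R_def)
  qed
  then show ?thesis using pv(2) by simp
qed

text \<open>
  Far away \<open>u\<close> is below half its maximum, so there \<open>c = u x\<close> bounds the second difference from below.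
\<close>
lemma hilbert_transform_pos_at_pos_max:
  assumes f: "holder_decay \<alpha> \<rho> f" and "\<alpha> > 0" and f2: "integrable lborel (\<lambda>x. (f x)\<^sup>2)"
    and d: "\<And>t. (u has_real_derivative f t) (at t)"
    and bdd: "\<And>t. \<bar>u t\<bar> \<le> B" and lim: "(u \<longlongrightarrow> 0) at_infinity"
    and max: "\<And>t. u t \<le> u x" and pos: "u x > 0"
  shows "hilbert_transform f x > 0"
proof -
  have "u x / 2 > 0" using pos by simp
  then obtain R where R: "\<And>t. R \<le> \<bar>t\<bar> \<Longrightarrow> \<bar>u t\<bar> < u x / 2"
    using lim unfolding Lim_at_infinity dist_real_def by fastforce
  define S where "S = \<bar>R\<bar> + \<bar>x\<bar> + 1"
  have "u x / S \<le> pi * hilbert_transform f x"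
  proof (rule hilbert_transform_at_max[OF f \<open>\<alpha> > 0\<close> f2 d bdd max])
    show "u x \<ge> 0" "S \<ge> 1" using pos by (auto simp: S_def)
    fix s assume "S \<le> s"
    then have "R \<le> \<bar>x + s\<bar>" "R \<le> \<bar>x - s\<bar>" by (auto simp: S_def)
    then show "u x \<le> 2 * u x - u (x + s) - u (x - s)" using R[of "x + s"] R[of "x - s"] by linarith
  qed
  moreover have "u x / S > 0" using pos by (simp add: S_def)
  ultimately have "pi * hilbert_transform f x > 0" by linarith
  then show ?thesis by (simp add: zero_less_mult_iff)
qed

section \<open>Functions that vanish at infinity\<close>

lemma bounded_deriv_imp_lipschitz:
  fixes w :: "real \<Rightarrow> real"
  assumes "\<And>x. (w has_real_derivative f x) (at x)" "\<And>x. \<bar>f x\<bar> \<le> L"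
  shows "\<bar>w x - w t\<bar> \<le> L * \<bar>x - t\<bar>"
  using field_differentiable_bound[of UNIV w f L x t] assms by simp

text \<open>
  If \<open>\<bar>w x\<bar> \<ge> e\<close>, then \<open>\<bar>w\<bar> \<ge> e / 2\<close> on an interval around \<open>x\<close> of fixed length, and this interval
  carries a fixed amount of the integral of \<open>w\<^sup>2\<close>. The tails of that integral tend to zero.
\<close>
lemma lipschitz_square_integrable_vanishes:
  fixes w :: "real \<Rightarrow> real"
  assumes lip: "\<And>x t. \<bar>w x - w t\<bar> \<le> L * \<bar>x - t\<bar>" and w2: "integrable lborel (\<lambda>x. (w x)\<^sup>2)"
  shows "(w \<longlongrightarrow> 0) at_infinity"
  unfolding Lim_at_infinity
proof (intro allI impI)
  fix e :: real assume "e > 0"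
  define d where "d = e / (2 * (\<bar>L\<bar> + 1))"
  have "d > 0" using \<open>e > 0\<close> by (simp add: d_def)
  have lip': "\<bar>w x - w t\<bar> \<le> (\<bar>L\<bar> + 1) * \<bar>x - t\<bar>" for x t
    using lip[of x t] mult_right_mono[of L "\<bar>L\<bar> + 1" "\<bar>x - t\<bar>"] by linarith
  have wc: "continuous_on UNIV w"
    by (rule lipschitz_on_continuous_on[OF lipschitz_onI[of UNIV w "\<bar>L\<bar> + 1"]])
       (use lip' in \<open>auto simp: dist_real_def\<close>)
  then have [measurable]: "w \<in> borel_measurable borel" by (rule borel_measurable_continuous_onI)
  let ?T = "\<lambda>R. LINT t|lborel. indicator {t. R \<le> \<bar>t\<bar>} t * (w t)\<^sup>2"
  have "(?T \<longlongrightarrow> (LINT t|(lborel :: real measure). 0)) at_top"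
  proof (rule integral_dominated_convergence_at_top[where
        s = "\<lambda>R t. indicator {t. R \<le> \<bar>t\<bar>} t * (w t)\<^sup>2" and f = "\<lambda>_. 0" and w = "\<lambda>t. (w t)\<^sup>2"])
    show "integrable lborel (\<lambda>t. (w t)\<^sup>2)" by (rule w2)
    show "\<forall>\<^sub>F R in at_top. AE t in lborel. norm (indicator {t. R \<le> \<bar>t\<bar>} t * (w t)\<^sup>2) \<le> (w t)\<^sup>2"
      by (intro always_eventually allI AE_I2) (auto simp: indicator_def)
    show "AE t in lborel. ((\<lambda>R. indicator {t. R \<le> \<bar>t\<bar>} t * (w t)\<^sup>2) \<longlongrightarrow> 0) at_top"
    proof (rule AE_I2)
      fix t :: real
      have "\<forall>\<^sub>F R in at_top. indicator {t. R \<le> \<bar>t\<bar>} t * (w t)\<^sup>2 = 0"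
        using eventually_gt_at_top[of "\<bar>t\<bar>"] by eventually_elim (simp add: indicator_def)
      then show "((\<lambda>R. indicator {t. R \<le> \<bar>t\<bar>} t * (w t)\<^sup>2) \<longlongrightarrow> 0) at_top"
        by (rule tendsto_eventually)
    qed
  qed auto
  then have "\<forall>\<^sub>F R in at_top. ?T R < d * e\<^sup>2 / 2"
    using \<open>d > 0\<close> \<open>e > 0\<close> by (intro order_tendstoD(2)[where y = 0]) auto
  then obtain R where R: "?T R < d * e\<^sup>2 / 2"
    by (auto simp: eventually_at_top_linorder)
  show "\<exists>b. \<forall>x. b \<le> norm x \<longrightarrow> dist (w x) 0 < e"
  proof (intro exI[of _ "R + d"] allI impI, rule ccontr)
    fix x :: real
    assume x: "R + d \<le> norm x" "\<not> dist (w x) 0 < e"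
    have half: "(e / 2)\<^sup>2 \<le> (w t)\<^sup>2" if "\<bar>x - t\<bar> \<le> d" for t
    proof -
      have "\<bar>w x - w t\<bar> \<le> (\<bar>L\<bar> + 1) * d"
        using lip'[of x t] mult_left_mono[OF that, of "\<bar>L\<bar> + 1"] by linarith
      also have "\<dots> = e / 2" by (simp add: d_def field_simps)
      finally have "\<bar>w x - w t\<bar> \<le> e / 2" .
      moreover have "e \<le> \<bar>w x\<bar>" using x(2) by simp
      ultimately have "e / 2 \<le> \<bar>w t\<bar>" by linarith
      then show ?thesis using \<open>e > 0\<close> power_mono[of "e / 2" "\<bar>w t\<bar>" 2] by simp
    qed
    have "d * e\<^sup>2 / 2 = (LINT t|lborel. (e / 2)\<^sup>2 * indicator {x - d..x + d} t)"
      using \<open>d > 0\<close> by (simp add: power2_eq_square)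
    also have "\<dots> \<le> ?T R"
    proof (rule integral_mono)
      show "integrable lborel (\<lambda>t. (e / 2)\<^sup>2 * indicator {x - d..x + d} t)"
        using \<open>d > 0\<close> by (intro integrable_mult_right integrable_real_indicator) auto
      show "integrable lborel (\<lambda>t. indicator {t. R \<le> \<bar>t\<bar>} t * (w t)\<^sup>2)"
        using integrable_mult_indicator[OF _ w2, of "{t. R \<le> \<bar>t\<bar>}"] by simp
      fix t
      show "(e / 2)\<^sup>2 * indicator {x - d..x + d} t \<le> indicator {t. R \<le> \<bar>t\<bar>} t * (w t)\<^sup>2"
      proof (cases "\<bar>x - t\<bar> \<le> d")
        case True
        then have "R \<le> \<bar>t\<bar>" using x(1) by simp
        then show ?thesis using half[OF True] by (simp add: indicator_def)
      next
        case False
        then show ?thesis by (auto simp: indicator_def)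
      qed
    qed
    finally show False using R by simp
  qed
qed

lemma vanishing_attains_max:
  fixes u :: "real \<Rightarrow> real"
  assumes "continuous_on UNIV u" "(u \<longlongrightarrow> 0) at_infinity" "u a > 0"
  obtains x where "u x > 0" "\<And>t. u t \<le> u x"
proof -
  obtain R where R: "\<And>t. R \<le> \<bar>t\<bar> \<Longrightarrow> \<bar>u t\<bar> < u a"
    using assms(2,3) unfolding Lim_at_infinity by (auto simp: dist_real_def)
  let ?I = "{- max R \<bar>a\<bar>..max R \<bar>a\<bar>}"
  have "a \<in> ?I" by auto
  obtain x where x: "x \<in> ?I" "\<And>t. t \<in> ?I \<Longrightarrow> u t \<le> u x"
    using continuous_attains_sup[of ?I u] \<open>a \<in> ?I\<close> continuous_on_subset[OF assms(1)]
    by (metis compact_Icc empty_iff subset_UNIV)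
  show thesis
  proof (rule that)
    show "u x > 0" using x(2)[OF \<open>a \<in> ?I\<close>] assms(3) by simp
    fix t
    show "u t \<le> u x"
    proof (cases "t \<in> ?I")
      case False
      then have "R \<le> \<bar>t\<bar>" by auto
      then show ?thesis using R[of t] x(2)[OF \<open>a \<in> ?I\<close>] by linarith
    qed (rule x(2))
  qed
qed

lemma integral_derivative_vanishing:
  fixes F f :: "real \<Rightarrow> real"
  assumes d: "\<And>x. (F has_real_derivative f x) (at x)" and c: "continuous_on UNIV f"
    and i: "integrable lborel f" and lim: "(F \<longlongrightarrow> 0) at_infinity"
  shows "(LINT x|lborel. f x) = 0"
proof -
  have "(LBINT x=-\<infinity>..\<infinity>. f x) = 0 - 0"
  proof (rule interval_integral_FTC_integrable[where F = F])
    show "(F has_vector_derivative f x) (at x)" for x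
      using d has_real_derivative_iff_has_vector_derivative by blast
    show "isCont f x" for x using c by (simp add: continuous_on_eq_continuous_at)
    show "set_integrable lborel (einterval (-\<infinity>) \<infinity>) f" using i by (simp add: set_integrable_def)
    have "(F \<longlongrightarrow> 0) at_top" "(F \<longlongrightarrow> 0) at_bot"
      using lim at_top_le_at_infinity at_bot_le_at_infinity tendsto_mono by blast+
    then show "((F \<circ> real_of_ereal) \<longlongrightarrow> 0) (at_right (-\<infinity>))" "((F \<circ> real_of_ereal) \<longlongrightarrow> 0) (at_left \<infinity>)"
      by (simp_all add: ereal_tendsto_simps)
  qed simp
  then show ?thesis by (simp add: interval_lebesgue_integral_def set_lebesgue_integral_def)
qed

lemma continuous_integral_square_0:
  fixes w :: "real \<Rightarrow> real"
  assumes c: "continuous_on UNIV w" and i: "integrable lborel (\<lambda>x. (w x)\<^sup>2)"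
    and z: "(LINT x|lborel. (w x)\<^sup>2) = 0"
  shows "w x = 0"
proof (rule ccontr)
  assume "w x \<noteq> 0"
  let ?S = "{x. w x \<noteq> 0}"
  have "open ?S" using open_Collect_neq[OF c continuous_on_const] .
  have "AE x in lborel. w x = 0"
    using integral_nonneg_eq_0_iff_AE[OF i] z by simp
  then have "?S \<in> null_sets lborel"
    using \<open>open ?S\<close> by (subst AE_iff_null_sets) (auto elim: eventually_mono)
  then have "negligible ?S"
    by (simp add: negligible_iff_null_sets null_sets_completionI)
  then show False using open_not_negligible[OF \<open>open ?S\<close>] \<open>w x \<noteq> 0\<close> by auto
qed

lemma square_integrable_mult_bounded:
  fixes f u :: "real \<Rightarrow> real"
  assumes "integrable lborel (\<lambda>x. (f x)\<^sup>2)" "\<And>x. \<bar>u x\<bar> \<le> B"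
    and [measurable]: "f \<in> borel_measurable borel" "u \<in> borel_measurable borel"
  shows "integrable lborel (\<lambda>x. (u x * f x)\<^sup>2)"
proof (rule Bochner_Integration.integrable_bound)
  show "integrable lborel (\<lambda>x. B\<^sup>2 * (f x)\<^sup>2)" using assms(1) by simp
  show "AE x in lborel. norm ((u x * f x)\<^sup>2) \<le> norm (B\<^sup>2 * (f x)\<^sup>2)"
  proof (rule AE_I2)
    fix x
    have "(u x)\<^sup>2 \<le> B\<^sup>2" using power_mono[OF assms(2)[of x], of 2] by simp
    then show "norm ((u x * f x)\<^sup>2) \<le> norm (B\<^sup>2 * (f x)\<^sup>2)"
      by (simp add: power_mult_distrib abs_mult mult_right_mono)
  qed
qed measurable

section \<open>Triviality of the solutions\<close>

text \<open>
  When the equation is multiplied by \<open>x f x\<close> and integrated, the three nonlocal terms drop out by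
  \<open>hilbert_weighted_identity\<close>, because \<open>f\<close> has integral zero, and the local term is \<open>- (\<mu>/2) \<integral> w\<^sup>2\<close>.
\<close>
lemma babenko_trivial_if_decaying:
  fixes w f :: "real \<Rightarrow> real"
  assumes \<alpha>: "0 < \<alpha>" "\<alpha> \<le> 1" and "\<rho> > 1" and "\<mu> \<noteq> 0"
    and d: "\<And>x. (w has_real_derivative f x) (at x)"
    and f: "holder_decay \<alpha> \<rho> f"
    and w2: "integrable lborel (\<lambda>x. (w x)\<^sup>2)" and dec: "\<And>x. \<bar>w x\<bar> \<le> C * (1 + \<bar>x\<bar>) powr - \<rho>"
    and eq: "\<And>x. hilbert_transform f x =
      \<mu> * (w x + w x * hilbert_transform f x + hilbert_transform (\<lambda>t. w t * f t) x)"
  shows "w x = 0"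
proof -
  define g where "g = (\<lambda>t. w t * f t)"
  let ?D = "hilbert_transform f" and ?E = "hilbert_transform g"
  have "\<rho> \<ge> 0" using \<open>\<rho> > 1\<close> by simp
  have "C \<ge> 0" using dec[of 0] by simp
  have bdd: "\<bar>w x\<bar> \<le> C" for x
    using dec[of x] mult_left_mono[OF weight_le_1[OF \<open>\<rho> \<ge> 0\<close>, of x] \<open>C \<ge> 0\<close>] by simp
  have xw: "\<bar>x * w x\<bar> \<le> C" for x
  proof -
    have "\<bar>x\<bar> * \<bar>w x\<bar> \<le> (1 + \<bar>x\<bar>) * (C * (1 + \<bar>x\<bar>) powr - \<rho>)"
      using dec[of x] by (intro mult_mono) auto
    also have "\<dots> = C * ((1 + \<bar>x\<bar>) * (1 + \<bar>x\<bar>) powr - \<rho>)" by simp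
    also have "\<dots> \<le> C * 1"
      using \<open>\<rho> > 1\<close> \<open>C \<ge> 0\<close> by (intro mult_left_mono one_plus_abs_mult_weight_le_1) auto
    finally show ?thesis by (simp add: abs_mult)
  qed
  obtain L where L: "L > 0" "\<And>x. \<bar>f x\<bar> \<le> L * (1 + \<bar>x\<bar>) powr - \<rho>" using holder_decayE[OF f] by metis
  have "\<bar>f x\<bar> \<le> L" for x
    using L(2)[of x] mult_left_mono[OF weight_le_1[OF \<open>\<rho> \<ge> 0\<close>, of x], of L] L(1) by linarith
  then have lip: "\<bar>w x - w t\<bar> \<le> L * \<bar>x - t\<bar>" for x t
    by (rule bounded_deriv_imp_lipschitz[OF d])
  have wc: "continuous_on UNIV w"
    using d by (meson DERIV_isCont continuous_at_imp_continuous_on)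
  have fc: "continuous_on UNIV f" by (rule holder_decay_continuous[OF f \<alpha>(1)])
  have lim: "(w \<longlongrightarrow> 0) at_infinity"
    by (rule lipschitz_square_integrable_vanishes[OF lip w2])
  have g: "holder_decay \<alpha> \<rho> g" unfolding g_def by (rule holder_decay_mult[OF f \<alpha>(2) bdd lip])
  have eq': "?D x = \<mu> * (w x + w x * ?D x + ?E x)" for x using eq[of x] by (simp add: g_def)

  have "(LINT x|lborel. f x) = 0"
    by (rule integral_derivative_vanishing[OF d fc holder_decay_integrable(1)[OF f \<alpha>(1) \<open>\<rho> > 1\<close>] lim])
  then have ff: "(LINT x|lborel. x * f x * ?D x) = 0"
    and fg: "(LINT x|lborel. x * f x * ?E x) + (LINT x|lborel. x * g x * ?D x) = 0"
    using hilbert_weighted_identity(2)[OF f f \<alpha>(1) \<open>\<rho> > 1\<close>]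
      hilbert_weighted_identity(2)[OF f g \<alpha>(1) \<open>\<rho> > 1\<close>] by simp_all
  note int = hilbert_weighted_identity(1)[OF f f \<alpha>(1) \<open>\<rho> > 1\<close>]
    hilbert_weighted_identity(1)[OF f g \<alpha>(1) \<open>\<rho> > 1\<close>] hilbert_weighted_identity(1)[OF g f \<alpha>(1) \<open>\<rho> > 1\<close>]
  \<comment> \<open>The equation times \<open>x f x\<close>, solved for the only local term; note \<open>f x w x = g x\<close>.\<close>
  have xwf: "x * w x * f x = (1 / \<mu>) * (x * f x * ?D x) - x * f x * ?E x - x * g x * ?D x" for x
  proof -
    have "x * f x * ?D x = \<mu> * (x * w x * f x + x * f x * ?E x + x * g x * ?D x)"
      by (subst eq') (simp add: g_def algebra_simps)
    then show ?thesis using \<open>\<mu> \<noteq> 0\<close> by (simp add: field_simps)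
  qed
  have xwf_int: "integrable lborel (\<lambda>x. x * w x * f x)"
    unfolding xwf using int by simp
  have "(LINT x|lborel. x * w x * f x) = (1 / \<mu>) * (LINT x|lborel. x * f x * ?D x)
      - (LINT x|lborel. x * f x * ?E x) - (LINT x|lborel. x * g x * ?D x)"
    unfolding xwf using int by simp
  also have "\<dots> = 0" using ff fg by simp
  finally have 0: "(LINT x|lborel. x * w x * f x) = 0" .
  \<comment> \<open>The integrand is the derivative of \<open>x (w x)\<^sup>2 / 2\<close>.\<close>
  have "(LINT x|lborel. (w x)\<^sup>2 / 2 + x * w x * f x) = 0"
  proof (rule integral_derivative_vanishing[where F = "\<lambda>x. x * (w x)\<^sup>2 / 2"])
    show "((\<lambda>x. x * (w x)\<^sup>2 / 2) has_real_derivative (w x)\<^sup>2 / 2 + x * w x * f x) (at x)" for x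
      by (auto intro!: derivative_eq_intros d simp: power2_eq_square)
    show "continuous_on UNIV (\<lambda>x. (w x)\<^sup>2 / 2 + x * w x * f x)"
      by (intro continuous_intros wc fc) auto
    show "integrable lborel (\<lambda>x. (w x)\<^sup>2 / 2 + x * w x * f x)" using w2 xwf_int by simp
    show "((\<lambda>x. x * (w x)\<^sup>2 / 2) \<longlongrightarrow> 0) at_infinity"
    proof (rule Lim_null_comparison)
      show "\<forall>\<^sub>F x in at_infinity. norm (x * (w x)\<^sup>2 / 2) \<le> C / 2 * \<bar>w x\<bar>"
      proof (intro always_eventually allI)
        fix x
        have "\<bar>x * w x\<bar> * \<bar>w x\<bar> \<le> C * \<bar>w x\<bar>" by (intro mult_right_mono xw) auto
        then show "norm (x * (w x)\<^sup>2 / 2) \<le> C / 2 * \<bar>w x\<bar>" by (simp add: power2_eq_square abs_mult)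
      qed
      show "((\<lambda>x. C / 2 * \<bar>w x\<bar>) \<longlongrightarrow> 0) at_infinity"
        by (rule tendsto_mult_right_zero[OF tendsto_rabs_zero[OF lim]])
    qed
  qed
  then have "(LINT x|lborel. (w x)\<^sup>2) = 0" using 0 w2 xwf_int by simp
  then show "w x = 0" by (rule continuous_integral_square_0[OF wc w2])
qed

text \<open>
  For \<open>D = H f\<close> and \<open>E = H (w f)\<close>, the inequality \<open>E \<le> w D\<close> turns the equation into
  \<open>(1 - 2 \<mu> w) D \<ge> \<mu> w\<close>. The signs of \<open>D\<close> and \<open>E\<close> at extremal points of \<open>w\<close> exclude negative
  values of \<open>w\<close>, and then positive ones.
\<close>
lemma babenko_trivial_if_nonpos:
  fixes w f :: "real \<Rightarrow> real"
  assumes \<alpha>: "0 < \<alpha>" "\<alpha> \<le> 1" and "\<mu> \<le> 0"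
    and d: "\<And>x. (w has_real_derivative f x) (at x)"
    and f: "holder_decay \<alpha> 0 f" and f2: "integrable lborel (\<lambda>x. (f x)\<^sup>2)"
    and w2: "integrable lborel (\<lambda>x. (w x)\<^sup>2)" and bdd: "\<And>x. \<bar>w x\<bar> \<le> B"
    and eq: "\<And>x. hilbert_transform f x =
      \<mu> * (w x + w x * hilbert_transform f x + hilbert_transform (\<lambda>t. w t * f t) x)"
  shows "w x = 0"
proof -
  define g where "g = (\<lambda>t. w t * f t)"
  let ?D = "hilbert_transform f" and ?E = "hilbert_transform g"
  obtain L where L: "\<And>x. \<bar>f x\<bar> \<le> L"
    using holder_decayE[OF f] by (metis minus_zero mult.right_neutral one_neq_zero powr_0 add_pos_nonneg abs_ge_zero less_numeral_extra(1) less_numeral_extra(3) powr_zero_eq_one)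
  have lip: "\<bar>w x - w t\<bar> \<le> L * \<bar>x - t\<bar>" for x t
    by (rule bounded_deriv_imp_lipschitz[OF d L])
  have wc: "continuous_on UNIV w"
    using d by (meson DERIV_isCont continuous_at_imp_continuous_on)
  have fm: "f \<in> borel_measurable borel" by (rule holder_decay_measurable[OF f \<alpha>(1)])
  have wm[measurable]: "w \<in> borel_measurable borel" by (rule borel_measurable_continuous_onI[OF wc])
  have lim: "(w \<longlongrightarrow> 0) at_infinity"
    by (rule lipschitz_square_integrable_vanishes[OF lip w2])
  have g: "holder_decay \<alpha> 0 g" unfolding g_def by (rule holder_decay_mult[OF f \<alpha>(2) bdd lip])
  have g2: "integrable lborel (\<lambda>x. (g x)\<^sup>2)"
    unfolding g_def by (rule square_integrable_mult_bounded[OF f2 bdd fm wm])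
  have eq': "?D x = \<mu> * (w x + w x * ?D x + ?E x)" for x using eq[of x] by (simp add: g_def)

  have D_max: "?D x > 0" if "\<And>t. w t \<le> w x" "w x > 0" for x
    by (rule hilbert_transform_pos_at_pos_max[OF f \<alpha>(1) f2 d bdd lim that])
  have D_min: "?D x < 0" if "\<And>t. w x \<le> w t" "w x < 0" for x
  proof -
    have n: "holder_decay \<alpha> 0 (\<lambda>t. - f t)"
      using holder_decay_mult[OF f \<alpha>(2), of "\<lambda>_. -1" 1 0] by simp
    have "hilbert_transform (\<lambda>t. - f t) x > 0"
    proof (rule hilbert_transform_pos_at_pos_max[OF n \<alpha>(1), where u = "\<lambda>t. - w t" and B = B])
      show "((\<lambda>t. - w t) has_real_derivative - f t) (at t)" for t by (intro DERIV_minus d)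
      show "((\<lambda>t. - w t) \<longlongrightarrow> 0) at_infinity" using tendsto_minus[OF lim] by simp
    qed (use f2 bdd that in auto)
    moreover have "hilbert_transform (\<lambda>t. - f t) x = - ?D x"
      using hilbert_transform_lincomb[OF \<alpha>(1) f f2 f f2, of 0 1 x] n f2 by simp
    ultimately show ?thesis by simp
  qed
  have E_max: "?E x \<ge> 0" if "\<And>t. \<bar>w t\<bar> \<le> \<bar>w x\<bar>" for x
  proof -
    have "0 / 1 \<le> pi * ?E x"
    proof (rule hilbert_transform_at_max[OF g \<alpha>(1) g2, where u = "\<lambda>t. (w t)\<^sup>2 / 2" and B = "B\<^sup>2 / 2"])
      show "((\<lambda>t. (w t)\<^sup>2 / 2) has_real_derivative g t) (at t)" for t
        unfolding g_def by (auto intro!: derivative_eq_intros d)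
      show "\<bar>(w t)\<^sup>2 / 2\<bar> \<le> B\<^sup>2 / 2" for t
        using power_mono[OF bdd[of t], of 2] by simp
      show m: "(w t)\<^sup>2 / 2 \<le> (w x)\<^sup>2 / 2" for t
        using power_mono[OF that[of t], of 2] by simp
      show "0 \<le> 2 * ((w x)\<^sup>2 / 2) - (w (x + s))\<^sup>2 / 2 - (w (x - s))\<^sup>2 / 2" for s
        using m[of "x + s"] m[of "x - s"] by linarith
    qed auto
    then show ?thesis using mult_le_cancel_left_pos[OF pi_gt_zero, of 0 "?E x"] by simp
  qed
  \<comment> \<open>For fixed \<open>x\<close>, \<open>w x D - E\<close> is the Hilbert transform of the derivative of
    \<open>t \<mapsto> - (w x - w t)\<^sup>2 / 2\<close>, which has its maximum at \<open>t = x\<close>.\<close>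
  have E_le: "?E x \<le> w x * ?D x" for x
  proof -
    let ?q = "\<lambda>t. (w x - w t) * f t"
    have B2: "\<bar>w x - w t\<bar> \<le> 2 * B" for t using bdd[of x] bdd[of t] by linarith
    have lip': "\<bar>(w x - w s) - (w x - w t)\<bar> \<le> L * \<bar>s - t\<bar>" for s t
      using lip[of t s] by (simp add: abs_minus_commute)
    have q: "holder_decay \<alpha> 0 ?q" by (rule holder_decay_mult[OF f \<alpha>(2) B2 lip'])
    have q2: "integrable lborel (\<lambda>t. (?q t)\<^sup>2)"
      by (rule square_integrable_mult_bounded[OF f2 B2 fm]) measurable
    have "0 / 1 \<le> pi * hilbert_transform ?q x"
    proof (rule hilbert_transform_at_max[OF q \<alpha>(1) q2, where u = "\<lambda>t. - (w x - w t)\<^sup>2 / 2" and B = "(2 * B)\<^sup>2 / 2"])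
      show "((\<lambda>t. - (w x - w t)\<^sup>2 / 2) has_real_derivative ?q t) (at t)" for t
        by (auto intro!: derivative_eq_intros d)
      show "\<bar>- (w x - w t)\<^sup>2 / 2\<bar> \<le> (2 * B)\<^sup>2 / 2" for t
        using power_mono[OF B2[of t], of 2] by simp
    qed auto
    moreover have eqq: "(w x - w t) * f t = w x * f t - 1 * g t" for t by (simp add: g_def algebra_simps)
    have "hilbert_transform ?q x = w x * ?D x - ?E x"
      using hilbert_transform_lincomb[OF \<alpha>(1) f f2 g g2 q[unfolded eqq] q2[unfolded eqq], of x]
      unfolding eqq by simp
    ultimately show ?thesis using mult_le_cancel_left_pos[OF pi_gt_zero, of 0 "w x * ?D x - ?E x"] by simp
  qed

  have nonneg: "w a \<ge> 0" for a
  proof (rule ccontr)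
    assume "\<not> w a \<ge> 0"
    then obtain x where x: "w x < 0" "\<And>t. w x \<le> w t"
      using vanishing_attains_max[of "\<lambda>t. - w t" a] tendsto_minus[OF lim] continuous_on_minus[OF wc] by auto
    have D: "?D x < 0" by (rule D_min[OF x(2,1)])
    show False
    proof (cases "\<mu> = 0")
      case True
      then show False using D eq'[of x] by simp
    next
      case False
      then have "\<mu> < 0" using \<open>\<mu> \<le> 0\<close> by simp
      have lower: "?D y \<ge> \<mu> * w y + 2 * \<mu> * w y * ?D y" for y
        using eq'[of y] mult_left_mono_neg[OF E_le[of y] \<open>\<mu> \<le> 0\<close>] by (simp add: algebra_simps)
      \<comment> \<open>Otherwise \<open>w\<close>, which vanishes at infinity, takes the value \<open>1 / (2 \<mu>)\<close> somewhere, and there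
        \<open>lower\<close> reads \<open>D \<ge> 1/2 + D\<close>.\<close>
      have "w x > 1 / (2 * \<mu>)"
      proof (rule ccontr)
        assume "\<not> w x > 1 / (2 * \<mu>)"
        have neg: "1 / (2 * \<mu>) < 0" using \<open>\<mu> < 0\<close> by (simp add: divide_pos_neg)
        obtain R where R: "\<And>t. R \<le> \<bar>t\<bar> \<Longrightarrow> \<bar>w t\<bar> < - (1 / (2 * \<mu>))"
          using lim neg unfolding Lim_at_infinity dist_real_def
          by (metis diff_zero neg_0_less_iff_less real_norm_def)
        have "\<bar>w \<bar>R\<bar>\<bar> < - (1 / (2 * \<mu>))" by (rule R) simp
        then have "1 / (2 * \<mu>) \<le> w \<bar>R\<bar>" by linarith
        then have "1 / (2 * \<mu>) \<in> range w"
          using connectedD_interval[OF connected_continuous_image[OF wc connected_UNIV], of "w x" "w \<bar>R\<bar>" "1 / (2 * \<mu>)"]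
            \<open>\<not> w x > 1 / (2 * \<mu>)\<close> by simp
        then obtain y where "w y = 1 / (2 * \<mu>)" by auto
        then have "2 * \<mu> * w y = 1" using \<open>\<mu> < 0\<close> by simp
        then show False using lower[of y] by (simp add: algebra_simps)
      qed
      then have "1 - 2 * \<mu> * w x > 0" using \<open>\<mu> < 0\<close> by (simp add: field_simps)
      then have "(1 - 2 * \<mu> * w x) * ?D x < 0" using D by (simp add: mult_pos_neg)
      moreover have "\<mu> * w x > 0" using \<open>\<mu> < 0\<close> x(1) by (simp add: mult_neg_neg)
      ultimately show False using lower[of x] by (simp add: algebra_simps)
    qed
  qed
  have "\<not> w a > 0" for a
  proof
    assume "w a > 0"
    then obtain x where x: "w x > 0" "\<And>t. w t \<le> w x"
      using vanishing_attains_max[OF wc lim] by blast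
    have D: "?D x > 0" by (rule D_max[OF x(2,1)])
    have E: "?E x \<ge> 0" using x nonneg by (intro E_max) auto
    have "\<mu> * (w x + w x * ?D x + ?E x) \<le> 0"
      using \<open>\<mu> \<le> 0\<close> x D E by (intro mult_nonpos_nonneg) auto
    then show False using eq'[of x] D by simp
  qed
  then show "w x = 0" using nonneg[of x] by (meson linorder_neqE_linordered_idom not_less)
qed

theorem theorem1p1:
  fixes \<mu> :: real and w :: "real \<Rightarrow> real"
  assumes "\<forall>x. hilbert_transform (deriv w) x =
             \<mu> * (w x + w x * hilbert_transform (deriv w) x
                  + hilbert_transform (\<lambda>t. w t * deriv w t) x)"
  shows "(\<mu> > 0 \<longrightarrow>
            (\<exists>\<alpha> \<in> {0<..<1}. \<exists>\<epsilon> \<in> {0<..<1}.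
               w \<in> sobolev_H1 \<inter> weighted_holder_space 1 \<alpha> (1 + \<epsilon>)) \<longrightarrow>
            (\<forall>x. w x = 0))
       \<and> (\<mu> \<le> 0 \<longrightarrow>
            (\<exists>\<alpha> \<in> {0<..<1}. w \<in> sobolev_H1 \<inter> weighted_holder_space 1 \<alpha> 0) \<longrightarrow>
            (INF x. ereal (1 + hilbert_transform (deriv w) x)) > 0 \<longrightarrow>
            (\<forall>x. w x = 0))"
proof (intro conjI impI allI)
  have eq: "hilbert_transform (deriv w) x = \<mu> * (w x + w x * hilbert_transform (deriv w) x
      + hilbert_transform (\<lambda>t. w t * deriv w t) x)" for x
    using assms by blast
  fix x
  assume "\<mu> > 0" and "\<exists>\<alpha> \<in> {0<..<1}. \<exists>\<epsilon> \<in> {0<..<1}. w \<in> sobolev_H1 \<inter> weighted_holder_space 1 \<alpha> (1 + \<epsilon>)"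
  then obtain \<alpha> \<epsilon> where *: "0 < \<alpha>" "\<alpha> < 1" "0 < \<epsilon>" "w \<in> sobolev_H1" "w \<in> weighted_holder_space 1 \<alpha> (1 + \<epsilon>)"
    by auto
  then have "0 \<le> 1 + \<epsilon>" by simp
  note W = weighted_holder_spaceD[OF *(5) this]
  obtain C where C: "\<And>x. \<bar>w x\<bar> \<le> C * (1 + \<bar>x\<bar>) powr - (1 + \<epsilon>)" using W(3) by blast
  have w2: "integrable lborel (\<lambda>x. (w x)\<^sup>2)"
    using *(4) by (simp add: sobolev_H1_def square_integrable_def)
  show "w x = 0"
    by (rule babenko_trivial_if_decaying[OF *(1) _ _ _ W(1,2) w2 C eq]) (use * \<open>\<mu> > 0\<close> in auto)
next
  have eq: "hilbert_transform (deriv w) x = \<mu> * (w x + w x * hilbert_transform (deriv w) x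
      + hilbert_transform (\<lambda>t. w t * deriv w t) x)" for x
    using assms by blast
  fix x
  assume "\<mu> \<le> 0" and "\<exists>\<alpha> \<in> {0<..<1}. w \<in> sobolev_H1 \<inter> weighted_holder_space 1 \<alpha> 0"
  then obtain \<alpha> where *: "0 < \<alpha>" "\<alpha> < 1" "w \<in> sobolev_H1" "w \<in> weighted_holder_space 1 \<alpha> 0"
    by auto
  note W = weighted_holder_spaceD[OF *(4) order_refl]
  obtain C where C0: "\<And>x. \<bar>w x\<bar> \<le> C * (1 + \<bar>x\<bar>) powr - 0" using W(3) by blast
  have C: "\<bar>w x\<bar> \<le> \<bar>C\<bar>" for x
  proof -
    have "C * (1 + \<bar>x\<bar>) powr - 0 \<le> \<bar>C\<bar> * 1"
      by (intro mult_mono weight_le_1) auto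
    then show ?thesis using C0[of x] by linarith
  qed
  have w2: "integrable lborel (\<lambda>x. (w x)\<^sup>2)"
    using *(3) by (simp add: sobolev_H1_def square_integrable_def)
  have w'2: "integrable lborel (\<lambda>x. (deriv w x)\<^sup>2)"
    by (rule sobolev_H1_square_integrable_deriv[OF *(3) W(1) holder_decay_continuous[OF W(2) *(1)]])
  show "w x = 0"
    by (rule babenko_trivial_if_nonpos[OF *(1) _ \<open>\<mu> \<le> 0\<close> W(1,2) w'2 w2 C eq]) (use * in auto)
qed

end
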